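(* Let $G$ be a finitely generated group. Assume that $G$ is neither abelian nor generalized dicyclic, and moreover that $G$ has an element of order at least $(2\operatorname{rank}(G))^{36}$ (infinite order being allowed). Then $G$ admits a locally finite Cayley graph $\mathrm{Cay}(G,S)$ whose only automorphisms are the left-multiplications by elements of $G$.
   Context: A graph is a simple undirected graph $(V,E)$: $E\subset V\times V$ is symmetric and disjoint from the diagonal. An automorphism is a permutation $\varphi$ of $V$ with $(x,y)\in E$ iff $(\varphi(x),\varphi(y))\in E$. A graph is locally finite if every vertex belongs to finitely many edges. For a generating set $S$ of $G$ with $1_G\notin S$, the Cayley graph $\mathrm{Cay}(G,S)$ has vertex set $G$ and edge set $\{(g,h)\mid g^{-1}h\in S\cup S^{-1}\}$; $G$ acts on it by left multiplication. $\operatorname{rank}(G)$ is the smallest cardinality of a generating set of $G$. A group $G$ is generalized dicyclic if it is non-abelian and has an abelian normal subgroup $A$ of index $2$ and an element $x\notin A$ of order $4$ such that $xax^{-1}=a^{-1}$ for every $a\in A$. *)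

theory Defs
  imports "HOL-Algebra.Algebra"
begin

type_synonym 'a vgraph = "'a set \<times> ('a \<times> 'a) set"

definition simple_graph :: "'a vgraph \<Rightarrow> bool" where
  "simple_graph \<Gamma> \<longleftrightarrow> snd \<Gamma> \<subseteq> fst \<Gamma> \<times> fst \<Gamma> \<and> sym (snd \<Gamma>) \<and> irrefl (snd \<Gamma>)"

definition locally_finite_graph :: "'a vgraph \<Rightarrow> bool" where
  "locally_finite_graph \<Gamma> \<longleftrightarrow>
     (\<forall>v \<in> fst \<Gamma>. finite {e \<in> snd \<Gamma>. fst e = v \<or> snd e = v})"

text \<open>
  Permutations of the vertex set are taken from \<^const>\<open>Bij\<close>, hence are extensional
  (\<^const>\<open>undefined\<close> off the vertex set): each automorphism is represented by exactly one
  HOL function.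
\<close>

definition graph_automorphisms :: "'a vgraph \<Rightarrow> ('a \<Rightarrow> 'a) set" where
  "graph_automorphisms \<Gamma> =
     {\<phi> \<in> Bij (fst \<Gamma>). \<forall>x \<in> fst \<Gamma>. \<forall>y \<in> fst \<Gamma>.
        (x, y) \<in> snd \<Gamma> \<longleftrightarrow> (\<phi> x, \<phi> y) \<in> snd \<Gamma>}"

definition generating_set :: "('a, 'b) monoid_scheme \<Rightarrow> 'a set \<Rightarrow> bool" where
  "generating_set G S \<longleftrightarrow> S \<subseteq> carrier G \<and> generate G S = carrier G"

definition finitely_generated :: "('a, 'b) monoid_scheme \<Rightarrow> bool" where
  "finitely_generated G \<longleftrightarrow> (\<exists>S. finite S \<and> generating_set G S)"

text \<open>Only meaningful for finitely generated \<open>G\<close>; otherwise the value is unspecified.\<close>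

definition group_rank :: "('a, 'b) monoid_scheme \<Rightarrow> nat" where
  "group_rank G = (LEAST n. \<exists>S. finite S \<and> card S = n \<and> generating_set G S)"

definition generalized_dicyclic :: "('a, 'b) monoid_scheme \<Rightarrow> bool" where
  "generalized_dicyclic G \<longleftrightarrow>
     group G \<and> \<not> comm_group G \<and>
     (\<exists>A. A \<lhd> G \<and> comm_group (G\<lparr>carrier := A\<rparr>) \<and> card (rcosets\<^bsub>G\<^esub> A) = 2 \<and>
        (\<exists>x \<in> carrier G - A. group.ord G x = 4 \<and>
           (\<forall>a \<in> A. x \<otimes>\<^bsub>G\<^esub> a \<otimes>\<^bsub>G\<^esub> inv\<^bsub>G\<^esub> x = inv\<^bsub>G\<^esub> a)))"

definition Cayley_graph :: "('a, 'b) monoid_scheme \<Rightarrow> 'a set \<Rightarrow> 'a vgraph" where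
  "Cayley_graph G S =
     (carrier G,
      {(g, h). g \<in> carrier G \<and> h \<in> carrier G \<and>
               inv\<^bsub>G\<^esub> g \<otimes>\<^bsub>G\<^esub> h \<in> S \<union> set_inv\<^bsub>G\<^esub> S})"

definition left_multiplications :: "('a, 'b) monoid_scheme \<Rightarrow> ('a \<Rightarrow> 'a) set" where
  "left_multiplications G = (\<lambda>g. \<lambda>x \<in> carrier G. g \<otimes>\<^bsub>G\<^esub> x) ` carrier G"

lemma (in group) simple_graph_Cayley_graph:
  assumes S: "S \<subseteq> carrier G" and one: "\<one> \<notin> S"
  shows "simple_graph (Cayley_graph G S)"
proof -
  let ?T = "S \<union> set_inv S"
  have inv_T: "inv t \<in> ?T" if "t \<in> ?T" for t
    using that S by (auto simp: SET_INV_def)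
  have one_T: "\<one> \<notin> ?T"
    using S one by (auto simp: SET_INV_def) (metis inv_eq_1_iff subsetD)
  have swap: "inv h \<otimes> g \<in> ?T"
    if "g \<in> carrier G" "h \<in> carrier G" "inv g \<otimes> h \<in> ?T" for g h
    using inv_T[OF that(3)] that by (simp add: inv_mult_group)
  show ?thesis
    unfolding simple_graph_def Cayley_graph_def sym_def irrefl_def
    using swap one_T by auto
qed

lemma (in group) left_multiplications_subset_graph_automorphisms:
  assumes S: "S \<subseteq> carrier G"
  shows "left_multiplications G \<subseteq> graph_automorphisms (Cayley_graph G S)"
proof -
  have bij: "(\<lambda>x \<in> carrier G. g \<otimes> x) \<in> Bij (carrier G)" if g: "g \<in> carrier G" for g
  proof -
    have "bij_betw (\<lambda>x \<in> carrier G. g \<otimes> x) (carrier G) (carrier G)"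
      by (rule bij_betwI[where g = "\<lambda>x. inv g \<otimes> x"]) (use g in \<open>auto simp: m_assoc[symmetric]\<close>)
    then show ?thesis
      by (simp add: Bij_def)
  qed
  have cancel: "inv (g \<otimes> x) \<otimes> (g \<otimes> y) = inv x \<otimes> y"
    if "g \<in> carrier G" "x \<in> carrier G" "y \<in> carrier G" for g x y
  proof -
    have "inv g \<otimes> (g \<otimes> y) = y"
      using that by (simp add: m_assoc[symmetric])
    then show ?thesis
      using that by (simp add: inv_mult_group m_assoc)
  qed
  show ?thesis
    using bij cancel
    by (auto simp: left_multiplications_def graph_automorphisms_def Cayley_graph_def)
qed

end

theory Submission
  imports Defs
begin

text \<open>
  Let \<open>a\<close> have large order, \<open>C = \<langle>a\<rangle>\<close>, and take \<open>S = A \<union> B\<close> with an interval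
  \<open>A = {a\<^sup>i | 0 < \<bar>i\<bar> \<le> m}\<close> and a small symmetric set \<open>B\<close> disjoint from \<open>C\<close>. An edge in \<open>A\<close> lies in
  more than \<open>2 |B|\<close> triangles and an edge in \<open>B\<close> in at most \<open>2 |B|\<close>, so automorphisms permute the
  cosets of \<open>C\<close>, and on each coset they act by \<open>g a\<^sup>i \<mapsto> \<phi>(g) a\<^sup>\<plusminus>\<^sup>i\<close>. To make \<open>x \<notin> C\<close>
  visible, \<open>B\<close> contains \<open>x\<close>, \<open>x c\<close> and \<open>x d\<close> for generic \<open>c, d \<in> C\<close>: the pair of distances from
  \<open>x\<close> to its companions then occurs in \<open>B\<close> only at \<open>x\<close> and \<open>x\<^sup>-\<^sup>1\<close>. Hence every automorphism satisfies
  \<open>\<phi>(g x) \<in> {\<phi>(g) x, \<phi>(g) x\<^sup>-\<^sup>1}\<close> for all \<open>x\<close> in a prescribed finite set of short words.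

  If such a \<open>\<phi>\<close> fixes \<open>1\<close> and inverts a generator \<open>u \<noteq> u\<^sup>-\<^sup>1\<close>, then comparing \<open>\<phi>(u h)\<close> along the two
  paths \<open>1 \<rightarrow> u \<rightarrow> u h\<close> and \<open>1 \<rightarrow> u h\<close> shows that \<open>u\<close> commutes with \<open>h\<close>, inverts \<open>h\<close>, or
  \<open>h\<^sup>2 = u\<^sup>-\<^sup>2\<close>. Applied to \<open>h\<close>, \<open>h b\<close> and \<open>h b\<^sup>2\<close> with \<open>b = a\<^sup>2\<close>, only one alternative
  survives, and \<open>G\<close> turns out to be abelian or generalized dicyclic, with the centraliser of \<open>b\<close> as the
  abelian subgroup.
\<close>

section \<open>Colour-preserving maps\<close>

lemma (in group) cancel_left [simp]:
  assumes "x \<in> carrier G" "y \<in> carrier G"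
  shows "x \<otimes> (inv x \<otimes> y) = y" "inv x \<otimes> (x \<otimes> y) = y"
  using assms by (simp_all flip: m_assoc)

lemmas (in group) word_simps = m_assoc inv_mult_group

text \<open>The relations between \<open>g\<close> and \<open>h\<close> that are compatible with a colour-preserving map
  fixing \<open>1\<close> and sending \<open>g\<close> to \<open>g\<^sup>-\<^sup>1\<close>; the third one says \<open>h\<^sup>2 = g\<^sup>-\<^sup>2\<close>.\<close>

definition (in group) reflection_related :: "'a \<Rightarrow> 'a \<Rightarrow> bool" where
  "reflection_related g h \<longleftrightarrow>
     g \<otimes> h = h \<otimes> g \<or> g \<otimes> h = inv h \<otimes> g \<or> g \<otimes> h = inv g \<otimes> inv h"

text \<open>As \<open>c\<close> commutes with \<open>g\<close> and \<open>h\<close>, it cancels from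
  the first alternative, while each of the other two can be solved for c^2. The two resulting values
  do not depend on \<open>c\<close>, so three elements \<open>c\<close> with distinct squares force
  commutation.\<close>

lemma (in group) commuting_square:
  assumes G: "g \<in> carrier G" "h \<in> carrier G" "c \<in> carrier G"
    and gc: "g \<otimes> c = c \<otimes> g" and hc: "h \<otimes> c = c \<otimes> h"
    and rel: "reflection_related g (h \<otimes> c)"
  shows "g \<otimes> h = h \<otimes> g \<or> c \<otimes> c \<in> {inv h \<otimes> (g \<otimes> (inv h \<otimes> inv g)),
    inv g \<otimes> (inv h \<otimes> (inv h \<otimes> inv g))}"
proof -
  have ghc: "c \<otimes> (g \<otimes> h) = g \<otimes> (h \<otimes> c)"
    using G gc hc by (metis m_assoc)
  have hgc: "c \<otimes> (h \<otimes> g) = h \<otimes> (c \<otimes> g)"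
    using G gc hc by (metis m_assoc)
  have igc: "inv g \<otimes> inv c = inv c \<otimes> inv g"
    using G gc by (metis inv_mult_group)
  consider "g \<otimes> (h \<otimes> c) = h \<otimes> c \<otimes> g" | "g \<otimes> (h \<otimes> c) = inv (h \<otimes> c) \<otimes> g"
    | "g \<otimes> (h \<otimes> c) = inv g \<otimes> inv (h \<otimes> c)"
    using rel unfolding reflection_related_def by blast
  then show ?thesis
  proof cases
    case 1
    then have "c \<otimes> (g \<otimes> h) = c \<otimes> (h \<otimes> g)"
      using G by (simp add: ghc hgc m_assoc)
    then show ?thesis using G by simp
  next
    case 2
    then have "c \<otimes> (g \<otimes> h) = inv c \<otimes> (inv h \<otimes> g)"
      using G by (simp add: ghc word_simps)
    then have "c \<otimes> (c \<otimes> (g \<otimes> h)) = inv h \<otimes> g"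
      using G by simp
    then have "c \<otimes> (c \<otimes> (g \<otimes> h)) \<otimes> (inv h \<otimes> inv g) = inv h \<otimes> g \<otimes> (inv h \<otimes> inv g)"
      by simp
    then show ?thesis using G by (simp add: word_simps)
  next
    case 3
    then have "c \<otimes> (g \<otimes> h) = inv c \<otimes> (inv g \<otimes> inv h)"
      using G igc by (simp add: ghc word_simps flip: m_assoc)
    then have "c \<otimes> (c \<otimes> (g \<otimes> h)) = inv g \<otimes> inv h"
      using G by simp
    then have "c \<otimes> (c \<otimes> (g \<otimes> h)) \<otimes> (inv h \<otimes> inv g) = inv g \<otimes> inv h \<otimes> (inv h \<otimes> inv g)"
      by simp
    then show ?thesis using G by (simp add: word_simps)
  qed
qed

text \<open>When \<open>g\<close> inverts \<open>c\<close>, the alternative from which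
  \<open>c\<close> cancels is the second one; the other two again confine c^2 to two values
  independent of \<open>c\<close>.\<close>

lemma (in group) anticommuting_square:
  assumes G: "g \<in> carrier G" "h \<in> carrier G" "c \<in> carrier G"
    and gc: "g \<otimes> c = inv c \<otimes> g" and hc: "h \<otimes> c = c \<otimes> h"
    and rel: "reflection_related g (h \<otimes> c)"
  shows "g \<otimes> h = inv h \<otimes> g \<or> c \<otimes> c \<in> {g \<otimes> (h \<otimes> (inv g \<otimes> inv h)),
    g \<otimes> (h \<otimes> (h \<otimes> g))}"
proof -
  have cg: "c \<otimes> g = g \<otimes> inv c"
    using G gc by (metis inv_closed inv_equality inv_inv inv_solve_right m_assoc m_closed r_inv)
  have hc': "inv h \<otimes> c = c \<otimes> inv h"
    using G hc by (metis inv_closed inv_solve_left inv_solve_right m_assoc m_closed)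
  have ghc: "inv c \<otimes> (g \<otimes> h) = g \<otimes> (h \<otimes> c)"
    using G gc hc by (metis m_assoc inv_closed)
  consider "g \<otimes> (h \<otimes> c) = h \<otimes> c \<otimes> g" | "g \<otimes> (h \<otimes> c) = inv (h \<otimes> c) \<otimes> g"
    | "g \<otimes> (h \<otimes> c) = inv g \<otimes> inv (h \<otimes> c)"
    using rel unfolding reflection_related_def by blast
  then show ?thesis
  proof cases
    case 1
    then have "inv c \<otimes> (g \<otimes> h) = c \<otimes> (h \<otimes> g)"
      using G by (simp add: ghc hc m_assoc)
    then have "c \<otimes> (c \<otimes> (h \<otimes> g)) = g \<otimes> h"
      using G by (metis cancel_left(1) m_closed inv_closed)
    then have "c \<otimes> (c \<otimes> (h \<otimes> g)) \<otimes> (inv g \<otimes> inv h) = g \<otimes> h \<otimes> (inv g \<otimes> inv h)"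
      by simp
    then show ?thesis using G by (simp add: word_simps)
  next
    case 2
    then have "inv c \<otimes> (g \<otimes> h) = inv c \<otimes> (inv h \<otimes> g)"
      using G by (simp add: ghc word_simps)
    then show ?thesis using G by simp
  next
    case 3
    then have "g \<otimes> (h \<otimes> c) = inv g \<otimes> (inv c \<otimes> inv h)"
      using G by (simp add: word_simps)
    then have *: "g \<otimes> h \<otimes> c = inv g \<otimes> inv c \<otimes> inv h"
      using G by (simp add: m_assoc)
    have "inv (c \<otimes> g) = inv (g \<otimes> inv c)" by (simp add: cg)
    then have "inv g \<otimes> inv c = c \<otimes> inv g" using G by (simp add: word_simps)
    then have "inv c \<otimes> (g \<otimes> h) = c \<otimes> (inv g \<otimes> inv h)"
      using * G ghc by (simp add: m_assoc)
    then have "c \<otimes> (c \<otimes> (inv g \<otimes> inv h)) = g \<otimes> h"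
      using G by (metis cancel_left(1) m_closed inv_closed)
    then have "c \<otimes> (c \<otimes> (inv g \<otimes> inv h)) \<otimes> (h \<otimes> g) = g \<otimes> h \<otimes> (h \<otimes> g)"
      by simp
    then show ?thesis using G by (simp add: word_simps)
  qed
qed

text \<open>Pigeonhole: the squares of 1, b, b^2 are 1, b^2, b^4, which are pairwise distinct,
  whereas \<open>commuting_square\<close> leaves only two values for them.\<close>

lemma (in group) commute_if_reflection_related:
  assumes G: "g \<in> carrier G" "h \<in> carrier G" "b \<in> carrier G"
    and gb: "g \<otimes> b = b \<otimes> g" and hb: "h \<otimes> b = b \<otimes> h"
    and b2: "b \<otimes> b \<noteq> \<one>" and b4: "(b \<otimes> b) \<otimes> (b \<otimes> b) \<noteq> \<one>"
    and rel: "\<And>c. c \<in> {\<one>, b, b \<otimes> b} \<Longrightarrow> reflection_related g (h \<otimes> c)"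
  shows "g \<otimes> h = h \<otimes> g"
proof (rule ccontr)
  assume "g \<otimes> h \<noteq> h \<otimes> g"
  moreover have "g \<otimes> c = c \<otimes> g" "h \<otimes> c = c \<otimes> h" "c \<in> carrier G"
    if "c \<in> {\<one>, b, b \<otimes> b}" for c
    using that G gb hb by (auto, (metis m_assoc)+)
  ultimately have "c \<otimes> c \<in> {inv h \<otimes> (g \<otimes> (inv h \<otimes> inv g)),
      inv g \<otimes> (inv h \<otimes> (inv h \<otimes> inv g))}" if "c \<in> {\<one>, b, b \<otimes> b}" for c
    using commuting_square[OF G(1,2)] rel that by blast
  from this[of \<one>] this[of b] this[of "b \<otimes> b"]
  have "\<one> = b \<otimes> b \<or> \<one> = (b \<otimes> b) \<otimes> (b \<otimes> b) \<or> b \<otimes> b = (b \<otimes> b) \<otimes> (b \<otimes> b)"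
    by auto
  then show False
    using G b2 b4 by (metis m_closed r_cancel_one)
qed

text \<open>The same pigeonhole argument on 1, b, b^2, now with the two values from
  \<open>anticommuting_square\<close>.\<close>

lemma (in group) invert_if_reflection_related:
  assumes G: "g \<in> carrier G" "h \<in> carrier G" "b \<in> carrier G"
    and gb: "g \<otimes> b = inv b \<otimes> g" and hb: "h \<otimes> b = b \<otimes> h"
    and b2: "b \<otimes> b \<noteq> \<one>" and b4: "(b \<otimes> b) \<otimes> (b \<otimes> b) \<noteq> \<one>"
    and rel: "\<And>c. c \<in> {\<one>, b, b \<otimes> b} \<Longrightarrow> reflection_related g (h \<otimes> c)"
  shows "g \<otimes> h = inv h \<otimes> g"
proof (rule ccontr)
  assume "g \<otimes> h \<noteq> inv h \<otimes> g"
  moreover have "g \<otimes> (b \<otimes> b) = inv (b \<otimes> b) \<otimes> g" 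
    using G gb by (metis inv_closed inv_mult_group m_assoc m_closed)
  then have "g \<otimes> c = inv c \<otimes> g" if "c \<in> {\<one>, b, b \<otimes> b}" for c
    using that G gb by auto
  moreover have "h \<otimes> c = c \<otimes> h" "c \<in> carrier G" if "c \<in> {\<one>, b, b \<otimes> b}" for c
    using that G gb hb by (auto, metis m_assoc)
  ultimately have "c \<otimes> c \<in> {g \<otimes> (h \<otimes> (inv g \<otimes> inv h)),
      g \<otimes> (h \<otimes> (h \<otimes> g))}" if "c \<in> {\<one>, b, b \<otimes> b}" for c
    using anticommuting_square[OF G(1,2)] rel that by blast
  from this[of \<one>] this[of b] this[of "b \<otimes> b"]
  have "\<one> = b \<otimes> b \<or> \<one> = (b \<otimes> b) \<otimes> (b \<otimes> b) \<or> b \<otimes> b = (b \<otimes> b) \<otimes> (b \<otimes> b)"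
    by auto
  then show False
    using G b2 b4 by (metis m_closed r_cancel_one)
qed

definition (in group) colour_preserving :: "'a set \<Rightarrow> ('a \<Rightarrow> 'a) \<Rightarrow> bool" where
  "colour_preserving S \<phi> \<longleftrightarrow> \<phi> \<in> carrier G \<rightarrow> carrier G \<and>
     (\<forall>g \<in> carrier G. \<forall>s \<in> S. \<phi> (g \<otimes> s) = \<phi> g \<otimes> s \<or> \<phi> (g \<otimes> s) = \<phi> g \<otimes> inv s)"

text \<open>Involutions are excluded because for them a flip changes nothing. Looking only at flips
  based at 1 is no restriction, since colour-preserving maps can be composed with left translations
  on both sides.\<close>

definition (in group) flippable :: "'a set \<Rightarrow> 'a \<Rightarrow> bool" where
  "flippable S g \<longleftrightarrow> g \<noteq> inv g \<and>
     (\<exists>\<phi>. colour_preserving S \<phi> \<and> \<phi> \<one> = \<one> \<and> \<phi> g = inv g)"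

text \<open>If \<phi> reversed the label \<open>s\<close> at some vertex \<open>g\<close>, the
  translated map \<open>?\<psi>\<close> would do so at 1 and witness that \<open>s\<close> is
  flippable.\<close>

lemma (in group) colour_preserving_unflippable:
  assumes S: "S \<subseteq> carrier G" and \<phi>: "colour_preserving S \<phi>"
    and s: "s \<in> S" "\<not> flippable S s" and g: "g \<in> carrier G"
  shows "\<phi> (g \<otimes> s) = \<phi> g \<otimes> s"
proof (rule ccontr)
  assume neq: "\<phi> (g \<otimes> s) \<noteq> \<phi> g \<otimes> s"
  have cl: "\<phi> x \<in> carrier G" if "x \<in> carrier G" for x
    using \<phi> that by (auto simp: colour_preserving_def)
  have sG: "s \<in> carrier G" using s S by auto
  let ?\<psi> = "\<lambda>x. inv (\<phi> g) \<otimes> \<phi> (g \<otimes> x)"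
  have "?\<psi> (x \<otimes> y) = ?\<psi> x \<otimes> y \<or> ?\<psi> (x \<otimes> y) = ?\<psi> x \<otimes> inv y"
    if "x \<in> carrier G" "y \<in> S" for x y
  proof -
    have "\<phi> (g \<otimes> x \<otimes> y) = \<phi> (g \<otimes> x) \<otimes> y \<or> \<phi> (g \<otimes> x \<otimes> y) = \<phi> (g \<otimes> x) \<otimes> inv y"
      using \<phi> g that unfolding colour_preserving_def by blast
    moreover have "y \<in> carrier G" using S that by auto
    ultimately show ?thesis
      using g that cl by (auto simp: m_assoc)
  qed
  then have \<psi>: "colour_preserving S ?\<psi>"
    using g cl unfolding colour_preserving_def by auto
  have one: "?\<psi> \<one> = \<one>" using g cl by simp
  have flip: "\<phi> (g \<otimes> s) = \<phi> g \<otimes> inv s"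
    using neq \<phi> g s unfolding colour_preserving_def by blast
  then have "?\<psi> s = inv s" using g cl sG by simp
  moreover have "s \<noteq> inv s" using neq flip by auto
  ultimately show False
    using \<psi> one s(2) unfolding flippable_def by blast
qed

text \<open>The edge from 1 labelled gh and the edge from \<phi>(g) = g^-1 labelled h each allow two
  values of \<phi>(gh). Of the four ways to match them, gh = g^-1 h contradicts g \<noteq> g^-1; the
  other three are the three alternatives, two of them after taking inverses.\<close>

lemma (in group) flippable_reflection_related:
  assumes S: "S \<subseteq> carrier G" and g: "flippable S g" "g \<in> carrier G"
    and h: "h \<in> S" "g \<otimes> h \<in> S"
  shows "reflection_related g h"
proof -
  obtain \<phi> where \<phi>: "colour_preserving S \<phi>" "\<phi> \<one> = \<one>" "\<phi> g = inv g" and gg: "g \<noteq> inv g"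
    using g unfolding flippable_def by blast
  have hG: "h \<in> carrier G" using h S by auto
  have "\<phi> (\<one> \<otimes> (g \<otimes> h)) = \<one> \<otimes> (g \<otimes> h) \<or> \<phi> (\<one> \<otimes> (g \<otimes> h)) = \<one> \<otimes> inv (g \<otimes> h)"
    using \<phi> h unfolding colour_preserving_def by (metis one_closed)
  then have 1: "\<phi> (g \<otimes> h) = g \<otimes> h \<or> \<phi> (g \<otimes> h) = inv h \<otimes> inv g"
    using g hG by (simp add: inv_mult_group)
  have 2: "\<phi> (g \<otimes> h) = inv g \<otimes> h \<or> \<phi> (g \<otimes> h) = inv g \<otimes> inv h"
    using \<phi> h g unfolding colour_preserving_def by metis
  have "g \<otimes> h \<noteq> inv g \<otimes> h" using gg g hG by simp
  with 1 2 consider "g \<otimes> h = inv g \<otimes> inv h" | "inv h \<otimes> inv g = inv g \<otimes> h"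
    | "inv h \<otimes> inv g = inv g \<otimes> inv h"
    by metis
  then show ?thesis
  proof cases
    case 2
    then have "inv (inv h \<otimes> inv g) = inv (inv g \<otimes> h)" by simp
    then have "g \<otimes> h = inv h \<otimes> g" using g hG by (simp add: inv_mult_group)
    then show ?thesis by (simp add: reflection_related_def)
  next
    case 3
    then have "inv (inv h \<otimes> inv g) = inv (inv g \<otimes> inv h)" by simp
    then have "g \<otimes> h = h \<otimes> g" using g hG by (simp add: inv_mult_group)
    then show ?thesis by (simp add: reflection_related_def)
  qed (simp add: reflection_related_def)
qed

text \<open>A map that flips \<open>u\<close> must fix the unflippable product uv. Seen from
  \<phi>(u) = u^-1, this is possible only if the label \<open>v\<close> is reversed there.\<close>

lemma (in group) flippable_mult_unflippable:
  assumes S: "S \<subseteq> carrier G" and u: "flippable S u" "u \<in> carrier G"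
    and v: "v \<in> S" "u \<otimes> v \<in> S" "\<not> flippable S (u \<otimes> v)"
  shows "u \<otimes> v = inv u \<otimes> inv v" "flippable S v"
proof -
  obtain \<phi> where \<phi>: "colour_preserving S \<phi>" "\<phi> \<one> = \<one>" "\<phi> u = inv u" and uu: "u \<noteq> inv u"
    using u unfolding flippable_def by blast
  have vG: "v \<in> carrier G" using v S by auto
  have "\<phi> (\<one> \<otimes> (u \<otimes> v)) = \<one> \<otimes> (u \<otimes> v)"
    using colour_preserving_unflippable[OF S \<phi>(1) v(2,3) one_closed] \<phi>(2) by simp
  then have 1: "\<phi> (u \<otimes> v) = u \<otimes> v"
    using u vG by simp
  have 2: "\<phi> (u \<otimes> v) = inv u \<otimes> v \<or> \<phi> (u \<otimes> v) = inv u \<otimes> inv v"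
    using \<phi> v u unfolding colour_preserving_def by metis
  have neq: "u \<otimes> v \<noteq> inv u \<otimes> v" using uu u vG by simp
  with 1 2 show "u \<otimes> v = inv u \<otimes> inv v" by metis
  show "flippable S v"
    using colour_preserving_unflippable[OF S \<phi>(1) v(1) _ u(2)] 1 neq \<phi>(3) by metis
qed

lemma (in group) colour_preserving_is_translation:
  assumes S: "S \<subseteq> carrier G" and Y: "Y \<subseteq> S" "generate G Y = carrier G"
    and unflip: "\<And>x. x \<in> Y \<Longrightarrow> \<not> flippable S x"
    and \<phi>: "colour_preserving S \<phi>" and h: "h \<in> carrier G"
  shows "\<phi> h = \<phi> \<one> \<otimes> h"
proof -
  have cl: "\<phi> x \<in> carrier G" if "x \<in> carrier G" for x
    using \<phi> that by (auto simp: colour_preserving_def)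
  have step: "\<phi> (g \<otimes> x) = \<phi> g \<otimes> x" if "x \<in> Y" "g \<in> carrier G" for g x
    using colour_preserving_unflippable[OF S \<phi>] that Y unflip by blast
  have "h \<in> generate G Y" using Y h by simp
  \<comment> \<open>The claim is made for every starting vertex \<open>g\<close>, so that in the
    product case the second factor can be read from the end point of the first.\<close>
  then have "\<forall>g \<in> carrier G. \<phi> (g \<otimes> h) = \<phi> g \<otimes> h"
  proof induction
    case one
    then show ?case using cl by simp
  next
    case (incl h)
    then show ?case using step by blast
  next
    case (inv h)
    have hG: "h \<in> carrier G" using inv Y S by auto
    show ?case
    proof
      fix g assume g: "g \<in> carrier G"
      have "\<phi> (g \<otimes> inv h \<otimes> h) = \<phi> (g \<otimes> inv h) \<otimes> h"
        using step inv g hG by blast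
      then have "\<phi> g = \<phi> (g \<otimes> inv h) \<otimes> h" using g hG by (simp add: m_assoc)
      then show "\<phi> (g \<otimes> inv h) = \<phi> g \<otimes> inv h"
        using g hG cl by (simp add: m_assoc)
    qed
  next
    case (eng h1 h2)
    have "h1 \<in> carrier G" "h2 \<in> carrier G"
      using eng Y S generate_in_carrier by blast+
    then show ?case using eng cl by (simp add: m_assoc[symmetric])
  qed
  then have "\<phi> (\<one> \<otimes> h) = \<phi> \<one> \<otimes> h" by blast
  then show ?thesis using h by simp
qed

section \<open>Groups generated by commuting elements, and a criterion for being generalized
  dicyclic\<close>

lemma (in group) generate_commuting:
  assumes Y: "Y \<subseteq> carrier G" and y: "y \<in> carrier G" and h: "h \<in> generate G Y"
    and comm: "\<And>x. x \<in> Y \<Longrightarrow> x \<otimes> y = y \<otimes> x"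
  shows "h \<otimes> y = y \<otimes> h"
  using h
proof induction
  case one
  then show ?case using y by simp
next
  case (incl h)
  then show ?case using comm by blast
next
  case (inv h)
  then have "h \<otimes> y = y \<otimes> h" "h \<in> carrier G" using comm Y by auto
  then show ?case
    using y by (metis inv_closed inv_solve_left inv_solve_right m_assoc m_closed)
next
  case (eng h1 h2)
  then have "h1 \<in> carrier G" "h2 \<in> carrier G"
    using Y generate_in_carrier by blast+
  then show ?case using eng y by (metis m_assoc)
qed

lemma (in group) generate_pairwise_commuting:
  assumes Y: "Y \<subseteq> carrier G" and comm: "\<And>x y. x \<in> Y \<Longrightarrow> y \<in> Y \<Longrightarrow> x \<otimes> y = y \<otimes> x"
    and h: "h \<in> generate G Y" "k \<in> generate G Y"
  shows "h \<otimes> k = k \<otimes> h"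
proof -
  have "x \<otimes> k = k \<otimes> x" if "x \<in> Y" for x
    using generate_commuting[OF Y _ h(2), of x] that comm Y by (metis subsetD)
  then show ?thesis
    using generate_commuting[OF Y _ h(1), of k] generate_in_carrier[OF Y h(2)] by blast
qed

text \<open>The abelian subgroup is K = \<langle>Y\<rangle>, and \<open>t\<close> is the element of
  order 4 inverting it. The element \<open>b\<close> serves to separate \<open>t\<close> from K:
  everything in K commutes with \<open>b\<close>, but \<open>t\<close> inverts \<open>b\<close>, and
  b^2 \<noteq> 1.\<close>

lemma (in group) generalized_dicyclicI:
  assumes nc: "\<not> comm_group G"
    and t: "t \<in> carrier G" and Y: "Y \<subseteq> carrier G"
    and gen: "generate G (insert t Y) = carrier G"
    and b: "b \<in> carrier G" "b \<otimes> b \<noteq> \<one>" "t \<otimes> b = inv b \<otimes> t"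
    and Yb: "\<And>y. y \<in> Y \<Longrightarrow> y \<otimes> b = b \<otimes> y"
    and t2: "t \<otimes> t \<in> Y" "t \<otimes> t \<noteq> \<one>"
    and tY: "\<And>y. y \<in> Y \<Longrightarrow> t \<otimes> y = inv y \<otimes> t"
    and comm: "\<And>y z. y \<in> Y \<Longrightarrow> z \<in> Y \<Longrightarrow> y \<otimes> z = z \<otimes> y"
  shows "generalized_dicyclic G"
proof -
  define K where "K = generate G Y"
  have subK: "subgroup K G" unfolding K_def using Y by (rule generate_is_subgroup)
  note Kcl = subgroup.m_closed[OF subK] subgroup.m_inv_closed[OF subK] subgroup.one_closed[OF subK]
  have KG: "k \<in> carrier G" if "k \<in> K" for k using subgroup.mem_carrier[OF subK that] .
  have Kcomm: "h \<otimes> k = k \<otimes> h" if "h \<in> K" "k \<in> K" for h k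
    using generate_pairwise_commuting[OF Y] comm that unfolding K_def by blast
  have tK: "t \<otimes> k = inv k \<otimes> t" if "k \<in> K" for k
    using that unfolding K_def
  proof induction
    case one
    then show ?case using t by simp
  next
    case (incl h)
    then show ?case using tY by blast
  next
    case (inv h)
    then have "h \<in> carrier G" "t \<otimes> h = inv h \<otimes> t" using Y tY by auto
    then show ?case
      using t by (metis inv_closed inv_inv inv_solve_left inv_solve_right m_assoc m_closed)
  next
    case (eng h k)
    then have hk: "h \<in> K" "k \<in> K" unfolding K_def by auto
    then have "h \<in> carrier G" "k \<in> carrier G" using KG by auto
    then show ?case
      using eng.IH Kcomm[OF hk] t by (metis inv_closed inv_mult_group m_assoc)
  qed
  have Kb: "k \<otimes> b = b \<otimes> k" if "k \<in> K" for k
    using generate_commuting[OF Y b(1)] Yb that unfolding K_def by blast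
  have tnK: "t \<notin> K"
  proof
    assume "t \<in> K"
    then have "inv b \<otimes> t = b \<otimes> t" using Kb b by metis
    then have "inv b = b" using b(1) t by simp
    then show False using b r_inv by metis
  qed
  have t2K: "t \<otimes> t \<in> K" using t2(1) unfolding K_def by (rule generate.incl)
  \<comment> \<open>As an element of K, t^2 is inverted by \<open>t\<close>; as a power of
    \<open>t\<close>, it commutes with \<open>t\<close>.\<close>
  have t4: "t \<otimes> t = inv (t \<otimes> t)"
  proof -
    have "t \<otimes> (t \<otimes> t) = inv (t \<otimes> t) \<otimes> t" using tK t2K by blast
    then have "t \<otimes> t \<otimes> t = inv (t \<otimes> t) \<otimes> t" using t by (simp add: m_assoc)
    then show ?thesis using t by simp
  qed
  have tinv: "inv t \<in> K #> t"
  proof -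
    have "inv (t \<otimes> t) \<otimes> t \<in> K #> t"
      using t2K Kcl unfolding r_coset_def by blast
    then show ?thesis using t by (simp add: inv_mult_group m_assoc)
  qed
  \<comment> \<open>The union of K and Kt is closed under products: t k = k^-1 t moves every
    \<open>t\<close> to the right, and t^2 lies in K.\<close>
  have cos: "g \<in> K \<or> g \<in> K #> t" if "g \<in> carrier G" for g
  proof -
    have "g \<in> generate G (insert t Y)" using gen that by simp
    then show ?thesis
    proof induction
      case one
      then show ?case using Kcl by blast
    next
      case (incl h)
      then show ?case using rcos_self[OF t subK] unfolding K_def by (auto intro: generate.incl)
    next
      case (inv h)
      then show ?case using tinv unfolding K_def by (auto intro: generate.inv)
    next
      case (eng g h)
      have *: "k \<otimes> (l \<otimes> t) \<in> K #> t" if "k \<in> K" "l \<in> K" for k l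
        using that t KG Kcl by (auto simp: r_coset_def m_assoc[symmetric])
      have **: "(k \<otimes> t) \<otimes> l \<in> K #> t" if "k \<in> K" "l \<in> K" for k l
      proof -
        have "(k \<otimes> t) \<otimes> l = k \<otimes> (inv l \<otimes> t)" using that t KG tK by (simp add: m_assoc)
        then show ?thesis using * that Kcl by simp
      qed
      have ***: "(k \<otimes> t) \<otimes> (l \<otimes> t) \<in> K" if "k \<in> K" "l \<in> K" for k l
      proof -
        have "(k \<otimes> t) \<otimes> (l \<otimes> t) = k \<otimes> (t \<otimes> l) \<otimes> t" using that t KG by (simp add: m_assoc)
        also have "\<dots> = k \<otimes> (inv l \<otimes> (t \<otimes> t))" using that t KG tK by (simp add: m_assoc)
        finally show ?thesis using that t2K Kcl by simp
      qed
      from eng.IH show ?case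
        using * ** *** Kcl unfolding r_coset_def by auto
    qed
  qed
  have Kinv: "t \<otimes> k \<otimes> inv t = inv k" if "k \<in> K" for k
    using tK[OF that] t KG[OF that] by (simp add: m_assoc)
  have "g \<otimes> k \<otimes> inv g \<in> K" if g: "g \<in> carrier G" and k: "k \<in> K" for g k
    using cos[OF g]
  proof
    assume "g \<in> K"
    then show ?thesis using k Kcl by blast
  next
    assume "g \<in> K #> t"
    then obtain l where l: "l \<in> K" "g = l \<otimes> t" unfolding r_coset_def by auto
    have "g \<otimes> k \<otimes> inv g = l \<otimes> (t \<otimes> k \<otimes> inv t) \<otimes> inv l"
      using l t k KG by (simp add: word_simps)
    also have "\<dots> = l \<otimes> inv k \<otimes> inv l" using Kinv k by simp
    finally show ?thesis using k l Kcl by simp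
  qed
  then have normal: "K \<lhd> G" using subK normal_inv_iff by blast
  have "comm_group (G\<lparr>carrier := K\<rparr>)"
    using subgroup.subgroup_is_group[OF subK is_group] Kcomm
    by (intro group.group_comm_groupI) auto
  moreover have "card (rcosets K) = 2"
  proof -
    have coset1: "K #> \<one> = K" using coset_mult_one subgroup.subset[OF subK] by blast
    have "rcosets K = {K, K #> t}"
    proof
      show "rcosets K \<subseteq> {K, K #> t}"
      proof
        fix c assume "c \<in> rcosets K"
        then obtain g where g: "g \<in> carrier G" "c = K #> g" unfolding RCOSETS_def by auto
        from cos[OF g(1)] show "c \<in> {K, K #> t}"
        proof
          assume "g \<in> K"
          then show ?thesis using g coset_join2[OF g(1) subK] by simp
        next
          assume "g \<in> K #> t"
          then show ?thesis using g repr_independence[OF _ t subK] by auto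
        qed
      qed
      show "{K, K #> t} \<subseteq> rcosets K"
        using t coset1 unfolding RCOSETS_def by auto
    qed
    moreover have "K \<noteq> K #> t" using rcos_self[OF t subK] tnK by auto
    ultimately show ?thesis by simp
  qed
  moreover have "group.ord G t = 4"
  proof -
    have p4: "t [^] (4::nat) = \<one>"
    proof -
      have "t [^] (4::nat) = (t \<otimes> t) \<otimes> (t \<otimes> t)"
        using t by (simp add: numeral_eq_Suc m_assoc)
      also have "\<dots> = (t \<otimes> t) \<otimes> inv (t \<otimes> t)" using t4 by metis
      finally show ?thesis using t by simp
    qed
    then have "ord t dvd 4" using pow_eq_id[OF t] by blast
    then have "ord t \<noteq> 0" by (metis dvd_0_left zero_neq_numeral)
    moreover have "ord t \<le> 4" "ord t \<noteq> 3" using \<open>ord t dvd 4\<close> by (auto intro: dvd_imp_le)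
    moreover have "t \<otimes> t = t [^] (2::nat)" using t by (simp add: numeral_eq_Suc)
    then have "\<not> ord t dvd 2" using t2(2) pow_eq_id[OF t] by metis
    then have "ord t \<noteq> 1" "ord t \<noteq> 2" by auto
    ultimately show ?thesis by linarith
  qed
  ultimately show ?thesis
    unfolding generalized_dicyclic_def
    using nc normal t tnK Kinv is_group by blast
qed

section \<open>Generators that cannot be flipped\<close>

lemma (in group) flippable_normalises_square:
  assumes S: "S \<subseteq> carrier G" and a: "a \<in> S" and g: "flippable S g" "g \<in> carrier G" "g \<otimes> a \<in> S"
  shows "g \<otimes> (a \<otimes> a) = (a \<otimes> a) \<otimes> g \<or> g \<otimes> (a \<otimes> a) = inv (a \<otimes> a) \<otimes> g"
proof -
  have aG: "a \<in> carrier G" using a S by auto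
  consider "g \<otimes> a = a \<otimes> g" | "g \<otimes> a = inv a \<otimes> g" | "g \<otimes> a = inv g \<otimes> inv a"
    using flippable_reflection_related[OF S g(1,2) a g(3)] unfolding reflection_related_def by blast
  then show ?thesis
  proof cases
    case 1
    then show ?thesis using aG g(2) by (metis m_assoc)
  next
    case 2
    then have "g \<otimes> (a \<otimes> a) = inv a \<otimes> (inv a \<otimes> g)"
      using aG g(2) by (metis m_assoc inv_closed)
    then show ?thesis using aG g(2) by (simp add: word_simps)
  next
    \<comment> \<open>Here a^2 = g^-2, which commutes with \<open>g\<close>. Passing from
      \<open>a\<close> to a^2 thus absorbs the third alternative, which is why b = a^2 is used from
      now on.\<close>
    case 3
    then have "g \<otimes> a \<otimes> a = inv g \<otimes> inv a \<otimes> a" by simp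
    then have "a \<otimes> a = inv g \<otimes> inv g"
      using aG g(2) by (simp add: m_assoc) (metis cancel_left(2) m_closed)
    then show ?thesis using g(2) by (simp add: m_assoc)
  qed
qed

text \<open>The elements conjugating \<open>b\<close> to \<open>b\<close> or to its inverse form a
  subgroup.\<close>

lemma (in group) normalises_cancel:
  assumes G: "u \<in> carrier G" "x \<in> carrier G" "b \<in> carrier G"
    and u: "u \<otimes> b = b \<otimes> u \<or> u \<otimes> b = inv b \<otimes> u"
    and ux: "(u \<otimes> x) \<otimes> b = b \<otimes> (u \<otimes> x) \<or> (u \<otimes> x) \<otimes> b = inv b \<otimes> (u \<otimes> x)"
  shows "x \<otimes> b = b \<otimes> x \<or> x \<otimes> b = inv b \<otimes> x"
proof -
  have u': "u \<otimes> inv b = b \<otimes> u" if "u \<otimes> b = inv b \<otimes> u"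
    using that G by (metis inv_closed inv_solve_left inv_solve_right m_assoc m_closed)
  have u'': "u \<otimes> inv b = inv b \<otimes> u" if "u \<otimes> b = b \<otimes> u"
    using that G by (metis inv_closed inv_solve_left inv_solve_right m_assoc m_closed)
  have "u \<otimes> (x \<otimes> b) = u \<otimes> (b \<otimes> x) \<or> u \<otimes> (x \<otimes> b) = u \<otimes> (inv b \<otimes> x)"
    using u ux u' u'' G by (metis inv_closed m_assoc)
  then show ?thesis using G by simp
qed

text \<open>Flippable elements conjugate a^2 to itself or its inverse, so \<open>x\<close> is
  unflippable. If \<open>u\<close> were flippable, then ux would be too, since otherwise
  \<open>x\<close> would have to be; but then \<open>u\<close> and ux, hence also \<open>x\<close>,
  would normalise a^2 in this way.\<close>

lemma (in group) unflippable_if_not_normalised: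
  assumes S: "S \<subseteq> carrier G" and a: "a \<in> S" and x: "x \<in> S" "u \<otimes> x \<in> S" "u \<otimes> x \<otimes> a \<in> S" "x \<otimes> a \<in> S"
    and u: "u \<in> carrier G" "u \<otimes> a \<in> S"
    and nn: "x \<otimes> (a \<otimes> a) \<noteq> (a \<otimes> a) \<otimes> x" "x \<otimes> (a \<otimes> a) \<noteq> inv (a \<otimes> a) \<otimes> x"
  shows "\<not> flippable S u"
proof
  assume flip: "flippable S u"
  have G: "x \<in> carrier G" "a \<in> carrier G" using x a S by auto
  have "\<not> flippable S x"
    using flippable_normalises_square[OF S a] x nn G by blast
  then have "flippable S (u \<otimes> x)"
    using flippable_mult_unflippable(2)[OF S flip u(1) x(1,2)] by blast
  then show False
    using normalises_cancel[of u x "a \<otimes> a"] flippable_normalises_square[OF S a flip u]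
      flippable_normalises_square[OF S a _ _ x(3)] u G nn by (metis m_closed)
qed

text \<open>Here \<open>b\<close> is central. A flippable \<open>u\<close> commutes with all of
  \<open>Y\<close>. For non-commuting y, z in \<open>Y\<close> the words u y and u y b are then
  unflippable, which gives y^2 = u^-2 = (y b)^2 and hence b^2 = 1.\<close>

lemma (in group) unflippable_if_central_square:
  assumes S: "S \<subseteq> carrier G" and Y: "Y \<subseteq> carrier G" "generate G Y = carrier G"
    and nc: "\<not> comm_group G"
    and b: "b \<in> carrier G" "b \<otimes> b \<noteq> \<one>" "(b \<otimes> b) \<otimes> (b \<otimes> b) \<noteq> \<one>"
    and Yb: "\<And>y. y \<in> Y \<Longrightarrow> y \<otimes> b = b \<otimes> y"
    and words: "\<And>x y z c. x \<in> insert \<one> Y \<Longrightarrow> y \<in> insert \<one> Y \<Longrightarrow> z \<in> insert \<one> Y \<Longrightarrow>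
       c \<in> {\<one>, b, b \<otimes> b, b \<otimes> (b \<otimes> b)} \<Longrightarrow> x \<otimes> (y \<otimes> (z \<otimes> c)) \<in> S"
    and u: "u \<in> Y"
  shows "\<not> flippable S u"
proof
  assume flip: "flippable S u"
  have YG: "y \<in> carrier G" if "y \<in> Y" for y using that Y by auto
  have bc: "g \<otimes> b = b \<otimes> g" if "g \<in> carrier G" for g
    using generate_commuting[OF Y(1) b(1), of g] that Y(2) Yb by blast
  have comm: "g \<otimes> y = y \<otimes> g" if "flippable S g" "g \<in> carrier G" "y \<in> Y"
      "\<And>c. c \<in> {\<one>, b, b \<otimes> b} \<Longrightarrow> y \<otimes> c \<in> S \<and> g \<otimes> (y \<otimes> c) \<in> S" for g y
    by (rule commute_if_reflection_related[OF that(2) YG[OF that(3)] b(1) bc[OF that(2)] bc[OF YG[OF that(3)]] b(2,3)])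
      (use that(4) in \<open>blast intro: flippable_reflection_related[OF S that(1,2)]\<close>)
  have ucomm: "u \<otimes> y = y \<otimes> u" if y: "y \<in> Y" for y
  proof (rule comm[OF flip YG[OF u] y])
    fix c assume c: "c \<in> {\<one>, b, b \<otimes> b}"
    then show "y \<otimes> c \<in> S \<and> u \<otimes> (y \<otimes> c) \<in> S"
      using words[of \<one> \<one> y c] words[of \<one> u y c] u y YG b(1) by auto
  qed
  obtain y z where yz: "y \<in> Y" "z \<in> Y" "y \<otimes> z \<noteq> z \<otimes> y"
  proof (rule ccontr)
    assume *: "\<not> thesis"
    have "comm_group G"
      using generate_pairwise_commuting[OF Y(1)] Y(2) * that by (intro group_comm_groupI) blast
    then show False using nc by simp
  qed
  \<comment> \<open>If u y c were flippable, it would commute with \<open>z\<close>; as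
    \<open>u\<close> and \<open>c\<close> commute with \<open>z\<close>, so would \<open>y\<close>.
    Testing u y c against z d with d = 1, b, b^2 uses the words u y z (c d), hence powers of
    \<open>b\<close> up to b^3.\<close>
  have key: "(y \<otimes> c) \<otimes> (y \<otimes> c) = inv u \<otimes> inv u" if c: "c \<in> {\<one>, b}" for c
  proof -
    have cG: "c \<in> carrier G" using c b(1) by auto
    have unflip: "\<not> flippable S (u \<otimes> (y \<otimes> c))"
    proof
      assume f: "flippable S (u \<otimes> (y \<otimes> c))"
      have *: "u \<otimes> (y \<otimes> c) \<otimes> z = z \<otimes> (u \<otimes> (y \<otimes> c))"
      proof (rule comm[OF f])
        fix d assume d: "d \<in> {\<one>, b, b \<otimes> b}"
        then have dG: "d \<in> carrier G" using b(1) by auto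
        have "c \<otimes> z = z \<otimes> c" using c yz YG b(1) bc[of z] by auto
        then have "u \<otimes> (y \<otimes> c) \<otimes> (z \<otimes> d) = u \<otimes> (y \<otimes> (z \<otimes> (c \<otimes> d)))"
          using u yz YG cG dG by (simp add: m_assoc) (simp flip: m_assoc)
        moreover have "c \<otimes> d \<in> {\<one>, b, b \<otimes> b, b \<otimes> (b \<otimes> b)}"
          using c d b(1) by auto
        ultimately show "z \<otimes> d \<in> S \<and> u \<otimes> (y \<otimes> c) \<otimes> (z \<otimes> d) \<in> S"
          using words[of u y z "c \<otimes> d"] words[of \<one> \<one> z d] u yz YG d dG by auto
      qed (use u yz YG cG in auto)
      have "u \<otimes> (c \<otimes> (y \<otimes> z)) = u \<otimes> (c \<otimes> (z \<otimes> y))"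
      proof -
        have cc: "g \<otimes> c = c \<otimes> g" if "g \<in> carrier G" for g using that c bc[OF that] by auto
        have 1: "u \<otimes> (y \<otimes> c) \<otimes> z = u \<otimes> (c \<otimes> (y \<otimes> z))"
        proof -
          have "u \<otimes> (y \<otimes> c) \<otimes> z = u \<otimes> (c \<otimes> y) \<otimes> z" using yz YG cc[of y] by simp
          then show ?thesis using u yz YG cG by (simp add: m_assoc)
        qed
        have "z \<otimes> (u \<otimes> (y \<otimes> c)) = u \<otimes> (z \<otimes> (y \<otimes> c))"
          using u yz YG cG ucomm[of z] by (simp flip: m_assoc)
        also have "\<dots> = u \<otimes> (c \<otimes> (z \<otimes> y))"
        proof -
          have "u \<otimes> (z \<otimes> y \<otimes> c) = u \<otimes> (c \<otimes> (z \<otimes> y))" using yz YG cc[of "z \<otimes> y"] by simp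
          then show ?thesis using u yz YG cG by (simp add: m_assoc)
        qed
        finally have 2: "z \<otimes> (u \<otimes> (y \<otimes> c)) = u \<otimes> (c \<otimes> (z \<otimes> y))" .
        show ?thesis using * 1 2 by simp
      qed
      then show False using yz YG u cG by simp
    qed
    have "u \<otimes> (y \<otimes> c) = inv u \<otimes> inv (y \<otimes> c)"
      using flippable_mult_unflippable(1)[OF S flip YG[OF u] _ _ unflip]
        words[of \<one> \<one> y c] words[of u \<one> y c] c u yz YG cG by auto
    then have "inv u \<otimes> (u \<otimes> (y \<otimes> c)) \<otimes> (y \<otimes> c) = inv u \<otimes> (inv u \<otimes> inv (y \<otimes> c)) \<otimes> (y \<otimes> c)"
      by simp
    then show ?thesis using u yz YG cG by (simp add: word_simps)
  qed
  have "(y \<otimes> b) \<otimes> (y \<otimes> b) = y \<otimes> y" using key[of \<one>] key[of b] yz YG by simp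
  moreover have "(y \<otimes> b) \<otimes> (y \<otimes> b) = y \<otimes> (y \<otimes> (b \<otimes> b))"
    using bc[of y] yz YG b(1) by (metis m_assoc m_closed)
  ultimately show False using b yz YG by simp
qed

text \<open>Conjugation by \<open>t\<close> is multiplicative, so inverting y, z and yz forces y^-1
  z^-1 = (yz)^-1.\<close>

lemma (in group) inverted_product_commute:
  assumes G: "t \<in> carrier G" "y \<in> carrier G" "z \<in> carrier G"
    and y: "t \<otimes> y = inv y \<otimes> t" and z: "t \<otimes> z = inv z \<otimes> t"
    and yz: "t \<otimes> (y \<otimes> z) = inv (y \<otimes> z) \<otimes> t"
  shows "y \<otimes> z = z \<otimes> y"
proof -
  have "inv y \<otimes> inv z \<otimes> t = inv y \<otimes> (t \<otimes> z)" using G z by (simp add: m_assoc)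
  also have "\<dots> = inv y \<otimes> t \<otimes> z" using G by (simp add: m_assoc)
  also have "\<dots> = t \<otimes> (y \<otimes> z)" using G by (simp add: m_assoc flip: y)
  also have "\<dots> = inv (y \<otimes> z) \<otimes> t" by (rule yz)
  finally have "inv (z \<otimes> y) = inv (y \<otimes> z)" using G by (simp add: inv_mult_group)
  then have "inv (inv (z \<otimes> y)) = inv (inv (y \<otimes> z))" by simp
  then show ?thesis using G by simp
qed

lemma (in group) inverts_if_square_eq:
  assumes G: "t \<in> carrier G" "h \<in> carrier G" and eq: "(t \<otimes> h) \<otimes> (t \<otimes> h) = t \<otimes> t"
  shows "t \<otimes> h = inv h \<otimes> t"
proof -
  have "h \<otimes> (t \<otimes> h) = t" using eq G by (simp add: m_assoc)
  then have "inv h \<otimes> (h \<otimes> (t \<otimes> h)) = inv h \<otimes> t" by simp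
  then show ?thesis using G by simp
qed

text \<open>The strategy is to show that a flippable \<open>u\<close> makes \<open>t\<close> invert
  a commuting family Z of elements centralising \<open>b\<close>, with t^2 in Z and t^2 \<noteq> 1.
  This is the excluded generalized dicyclic situation.\<close>

lemma (in group) unflippable_if_inverted_square:
  assumes S: "S \<subseteq> carrier G" and t: "t \<in> carrier G" and Y: "Y \<subseteq> carrier G"
    and gen: "generate G (insert t Y) = carrier G"
    and nc: "\<not> comm_group G" and nd: "\<not> generalized_dicyclic G"
    and b: "b \<in> carrier G" "b \<otimes> b \<noteq> \<one>" "(b \<otimes> b) \<otimes> (b \<otimes> b) \<noteq> \<one>"
    and tb: "t \<otimes> b = inv b \<otimes> t" and Yb: "\<And>y. y \<in> Y \<Longrightarrow> y \<otimes> b = b \<otimes> y"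
    and words: "\<And>x y z v w c. x \<in> T \<Longrightarrow> y \<in> T \<Longrightarrow> z \<in> T \<Longrightarrow> v \<in> T \<Longrightarrow> w \<in> T \<Longrightarrow>
       c \<in> {\<one>, b, b \<otimes> b} \<Longrightarrow> x \<otimes> (y \<otimes> (z \<otimes> (v \<otimes> (w \<otimes> c)))) \<in> S"
    and T: "T = {\<one>, t, t \<otimes> t} \<union> Y"
    and u: "u \<in> insert t Y"
  shows "\<not> flippable S u"
proof
  assume flip: "flippable S u"
  \<comment> \<open>The letters of \<open>T\<close> that centralise \<open>b\<close>; t^2 is among
    them because \<open>t\<close> inverts \<open>b\<close>.\<close>
  define Z where "Z = {\<one>, t \<otimes> t} \<union> Y"
  have ZT: "z \<in> T" and ZG: "z \<in> carrier G" if "z \<in> Z" for z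
    using that t Y unfolding Z_def T by auto
  have tT: "t \<in> T" "\<one> \<in> T" unfolding T by auto
  have oneZ: "\<one> \<in> Z" unfolding Z_def by auto
  have tib: "t \<otimes> inv b = b \<otimes> t"
    using tb t b(1) by (metis inv_closed inv_solve_left inv_solve_right m_assoc m_closed)
  have Zb: "z \<otimes> b = b \<otimes> z" if z: "z \<in> Z" for z
  proof -
    have "t \<otimes> t \<otimes> b = t \<otimes> (inv b \<otimes> t)" using t b(1) tb by (simp add: m_assoc)
    also have "\<dots> = t \<otimes> inv b \<otimes> t" using t b(1) by (simp add: m_assoc)
    also have "\<dots> = b \<otimes> (t \<otimes> t)" using t b(1) by (simp add: tib m_assoc)
    finally show ?thesis using z Yb b(1) unfolding Z_def by auto
  qed
  have ZZb: "(y \<otimes> z) \<otimes> b = b \<otimes> (y \<otimes> z)" if "y \<in> Z" "z \<in> Z" for y z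
    using Zb[OF that(1)] Zb[OF that(2)] ZG that b(1) by (metis m_assoc)
  have cG: "c \<in> carrier G" if "c \<in> {\<one>, b, b \<otimes> b}" for c using that b(1) by auto
  have inverts: "g \<otimes> h = inv h \<otimes> g"
    if "flippable S g" "g \<in> carrier G" "g \<otimes> b = inv b \<otimes> g" "h \<in> carrier G" "h \<otimes> b = b \<otimes> h"
      "\<And>c. c \<in> {\<one>, b, b \<otimes> b} \<Longrightarrow> h \<otimes> c \<in> S \<and> g \<otimes> (h \<otimes> c) \<in> S" for g h
    by (rule invert_if_reflection_related[OF that(2) that(4) b(1) that(3,5) b(2,3)])
      (use that(6) in \<open>blast intro: flippable_reflection_related[OF S that(1,2)]\<close>)
  have comm: "g \<otimes> h = h \<otimes> g"
    if "flippable S g" "g \<in> carrier G" "g \<otimes> b = b \<otimes> g" "h \<in> carrier G" "h \<otimes> b = b \<otimes> h"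
      "\<And>c. c \<in> {\<one>, b, b \<otimes> b} \<Longrightarrow> h \<otimes> c \<in> S \<and> g \<otimes> (h \<otimes> c) \<in> S" for g h
    by (rule commute_if_reflection_related[OF that(2) that(4) b(1) that(3,5) b(2,3)])
      (use that(6) in \<open>blast intro: flippable_reflection_related[OF S that(1,2)]\<close>)
  have dicyclic: False if t2: "t \<otimes> t \<noteq> \<one>" and tZ: "\<And>z. z \<in> Z \<Longrightarrow> t \<otimes> z = inv z \<otimes> t"
    and ZZ: "\<And>y z. y \<in> Z \<Longrightarrow> z \<in> Z \<Longrightarrow> y \<otimes> z = z \<otimes> y"
  proof -
    have "generate G (insert t Y) \<subseteq> generate G (insert t (insert (t \<otimes> t) Y))"
      by (rule mono_generate) auto
    moreover have "generate G (insert t (insert (t \<otimes> t) Y)) \<subseteq> carrier G"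
      by (rule generate_incl) (use t Y in auto)
    ultimately have gen': "generate G (insert t (insert (t \<otimes> t) Y)) = carrier G"
      using gen by auto
    have sub: "insert (t \<otimes> t) Y \<subseteq> carrier G" "insert (t \<otimes> t) Y \<subseteq> Z"
      using t Y unfolding Z_def by auto
    have "generalized_dicyclic G"
      by (rule generalized_dicyclicI[OF nc t sub(1) gen' b(1,2) tb])
        (use Zb t2 tZ ZZ sub(2) in blast)+
    then show False using nd by simp
  qed
  show False
  proof (cases "u = t")
    case True
    have tZZ: "t \<otimes> (y \<otimes> z) = inv (y \<otimes> z) \<otimes> t" if yz: "y \<in> Z" "z \<in> Z" for y z
    proof (rule inverts)
      fix c assume c: "c \<in> {\<one>, b, b \<otimes> b}"
      show "y \<otimes> z \<otimes> c \<in> S \<and> t \<otimes> (y \<otimes> z \<otimes> c) \<in> S"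
        using words[of \<one> \<one> \<one> y z c] words[of \<one> \<one> t y z c] tT ZT ZG yz c cG[OF c] t
        by (simp add: m_assoc)
    qed (use flip True t tb ZG yz ZZb in auto)
    have tZ: "t \<otimes> z = inv z \<otimes> t" if "z \<in> Z" for z
      using tZZ[OF oneZ that] ZG that by simp
    have "t \<otimes> t \<noteq> \<one>"
    proof
      assume "t \<otimes> t = \<one>"
      then have "inv t = t" using t by (simp add: inv_equality)
      then show False using flip True unfolding flippable_def by simp
    qed
    then show False
      by (rule dicyclic[OF _ tZ inverted_product_commute[OF t ZG ZG tZ tZ tZZ]])
  next
    case False
    then have uZ: "u \<in> Z" using u unfolding Z_def by auto
    have uG: "u \<in> carrier G" using ZG uZ by blast
    have uZZ: "u \<otimes> (y \<otimes> z) = (y \<otimes> z) \<otimes> u" if yz: "y \<in> Z" "z \<in> Z" for y z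
    proof (rule comm)
      fix c assume c: "c \<in> {\<one>, b, b \<otimes> b}"
      show "y \<otimes> z \<otimes> c \<in> S \<and> u \<otimes> (y \<otimes> z \<otimes> c) \<in> S"
        using words[of \<one> \<one> \<one> y z c] words[of \<one> \<one> u y z c] tT ZT uZ ZG yz c cG[OF c] uG
        by (simp add: m_assoc)
    qed (use flip uZ ZG yz ZZb Zb in auto)
    have uiZZ: "inv (y \<otimes> z) \<otimes> u = u \<otimes> inv (y \<otimes> z)" if "y \<in> Z" "z \<in> Z" for y z
      using uZZ[OF that] ZG that uG by (metis inv_closed inv_solve_left inv_solve_right m_assoc m_closed)
    have uib: "u \<otimes> inv b = inv b \<otimes> u"
      using Zb[OF uZ] uG b(1) by (metis inv_closed inv_solve_left inv_solve_right m_assoc m_closed)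
    have uiZ: "inv z \<otimes> u = u \<otimes> inv z" if "z \<in> Z" for z
      using uiZZ[OF oneZ that] ZG that by simp
    have utb: "u \<otimes> (t \<otimes> h) \<otimes> b = inv b \<otimes> (u \<otimes> (t \<otimes> h))"
      if h: "h \<in> carrier G" "h \<otimes> b = b \<otimes> h" for h
    proof -
      have "u \<otimes> (t \<otimes> h) \<otimes> b = u \<otimes> (t \<otimes> (h \<otimes> b))"
        using uG t b(1) h(1) by (simp add: m_assoc)
      also have "\<dots> = u \<otimes> ((t \<otimes> b) \<otimes> h)"
        using uG t b(1) h by (simp add: m_assoc)
      also have "\<dots> = (u \<otimes> inv b) \<otimes> (t \<otimes> h)"
        using uG t b(1) h(1) by (simp add: tb m_assoc)
      also have "\<dots> = inv b \<otimes> (u \<otimes> (t \<otimes> h))"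
        using uG t b(1) h(1) by (simp add: uib m_assoc)
      finally show ?thesis .
    qed
    \<comment> \<open>The element u t h inverts \<open>b\<close>, so once flippable it inverts every
      suitable \<open>k\<close> centralising \<open>b\<close>. Since \<open>u\<close> commutes with
      k^-1, it can be cancelled from that relation.\<close>
    have flip_inverts: "t \<otimes> (h \<otimes> k) = inv k \<otimes> (t \<otimes> h)"
      if f: "flippable S (u \<otimes> (t \<otimes> h))" and h: "h \<in> carrier G" "h \<otimes> b = b \<otimes> h"
        and k: "k \<in> carrier G" "k \<otimes> b = b \<otimes> k" "inv k \<otimes> u = u \<otimes> inv k"
        and kS: "\<And>c. c \<in> {\<one>, b, b \<otimes> b} \<Longrightarrow> k \<otimes> c \<in> S \<and> u \<otimes> (t \<otimes> h) \<otimes> (k \<otimes> c) \<in> S"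
      for h k
    proof -
      have "u \<otimes> (t \<otimes> h) \<otimes> k = inv k \<otimes> (u \<otimes> (t \<otimes> h))"
        by (rule inverts[OF f _ utb[OF h] k(1,2) kS]) (use uG t h in auto)
      also have "\<dots> = (inv k \<otimes> u) \<otimes> (t \<otimes> h)" using uG t h k(1) by (simp add: m_assoc)
      also have "\<dots> = u \<otimes> (inv k \<otimes> (t \<otimes> h))" using uG t h k by (simp add: m_assoc)
      finally show ?thesis using uG t h k(1) by (simp add: m_assoc)
    qed
    \<comment> \<open>Flip \<open>u\<close> and look at the product u v with v = t y z: if u v is
      unflippable, then u v = u^-1 v^-1, that is, v^2 = u^-2.\<close>
    have alternative: "(t \<otimes> (y \<otimes> z)) \<otimes> (t \<otimes> (y \<otimes> z)) = inv u \<otimes> inv u \<or> flippable S (u \<otimes> (t \<otimes> (y \<otimes> z)))"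
      if yz: "y \<in> Z" "z \<in> Z" for y z
    proof (rule disjCI)
      assume unflip: "\<not> flippable S (u \<otimes> (t \<otimes> (y \<otimes> z)))"
      let ?v = "t \<otimes> (y \<otimes> z)"
      have vG: "?v \<in> carrier G" using t ZG yz by simp
      have "?v \<in> S" "u \<otimes> ?v \<in> S"
        using words[of \<one> \<one> t y z \<one>] words[of \<one> u t y z \<one>] tT ZT uZ ZG yz uG t by auto
      then have "u \<otimes> ?v = inv u \<otimes> inv ?v"
        using flippable_mult_unflippable(1)[OF S flip uG _ _ unflip] by blast
      then have "inv u \<otimes> (u \<otimes> ?v) \<otimes> ?v = inv u \<otimes> (inv u \<otimes> inv ?v) \<otimes> ?v" by simp
      then show "?v \<otimes> ?v = inv u \<otimes> inv u"
        using uG vG by (simp add: m_assoc del: inv_mult_group)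
    qed
    \<comment> \<open>Comparing u t y z with \<open>y\<close> yields t y z y = y^-1 t y z = t y y z.
      This is the place where words with five letters, u t y z y, are used.\<close>
    have flip_commute: "y \<otimes> z = z \<otimes> y"
      if f: "flippable S (u \<otimes> (t \<otimes> (y \<otimes> z)))" and yz: "y \<in> Z" "z \<in> Z" and ty: "t \<otimes> y = inv y \<otimes> t"
      for y z
    proof -
      have "t \<otimes> (y \<otimes> z \<otimes> y) = inv y \<otimes> (t \<otimes> (y \<otimes> z))"
      proof (rule flip_inverts[OF f])
        fix c assume c: "c \<in> {\<one>, b, b \<otimes> b}"
        show "y \<otimes> c \<in> S \<and> u \<otimes> (t \<otimes> (y \<otimes> z)) \<otimes> (y \<otimes> c) \<in> S"
          using words[of \<one> \<one> \<one> \<one> y c] words[of u t y z y c] tT ZT uZ ZG yz c cG[OF c] uG t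
          by (simp add: m_assoc)
      qed (use ZG yz ZZb Zb uiZ in auto)
      also have "\<dots> = (inv y \<otimes> t) \<otimes> (y \<otimes> z)" using t ZG yz by (simp add: m_assoc)
      also have "\<dots> = t \<otimes> (y \<otimes> (y \<otimes> z))" using t ZG yz by (simp add: m_assoc flip: ty)
      finally show ?thesis using t ZG yz by (simp add: m_assoc)
    qed
    show False
    proof (cases "flippable S (u \<otimes> (t \<otimes> (\<one> \<otimes> \<one>)))")
      case True
      then have f: "flippable S (u \<otimes> (t \<otimes> \<one>))" by simp
      have tZZ: "t \<otimes> (y \<otimes> z) = inv (y \<otimes> z) \<otimes> t" if yz: "y \<in> Z" "z \<in> Z" for y z
      proof -
        have "t \<otimes> (\<one> \<otimes> (y \<otimes> z)) = inv (y \<otimes> z) \<otimes> (t \<otimes> \<one>)"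
        proof (rule flip_inverts[OF f])
          fix c assume c: "c \<in> {\<one>, b, b \<otimes> b}"
          show "y \<otimes> z \<otimes> c \<in> S \<and> u \<otimes> (t \<otimes> \<one>) \<otimes> (y \<otimes> z \<otimes> c) \<in> S"
            using words[of \<one> \<one> \<one> y z c] words[of \<one> u t y z c] tT ZT uZ ZG yz c cG[OF c] uG t
            by (simp add: m_assoc)
        qed (use ZG yz ZZb b(1) uiZZ in auto)
        then show ?thesis using t ZG yz by simp
      qed
      have tZ: "t \<otimes> z = inv z \<otimes> t" if "z \<in> Z" for z
        using tZZ[OF oneZ that] ZG that by simp
      \<comment> \<open>If t^2 = 1, then (u t)^2 = u u^-1 t^2 = 1, so u t would be an involution,
        which is never flippable.\<close>
      have "t \<otimes> t \<noteq> \<one>"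
      proof
        assume t2: "t \<otimes> t = \<one>"
        have "(u \<otimes> t) \<otimes> (u \<otimes> t) = u \<otimes> (t \<otimes> u) \<otimes> t" using uG t by (simp add: m_assoc)
        also have "\<dots> = \<one>" using uG t t2 by (simp add: tZ[OF uZ] m_assoc)
        finally have "inv (u \<otimes> t) = u \<otimes> t" using uG t by (simp add: inv_equality)
        then show False using f t unfolding flippable_def by simp
      qed
      then show False
        by (rule dicyclic[OF _ tZ inverted_product_commute[OF t ZG ZG tZ tZ tZZ]])
    next
      case nf: False
      then have t2: "t \<otimes> t = inv u \<otimes> inv u" using alternative[OF oneZ oneZ] t by simp
      have t2n: "t \<otimes> t \<noteq> \<one>"
      proof
        assume "t \<otimes> t = \<one>"
        then have "inv (inv u) = inv u" using t2 uG by (metis inv_closed inv_equality)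
        then show False using flip uG unfolding flippable_def by simp
      qed
      \<comment> \<open>Now t^2 = u^-2, so the first alternative reads (t y)^2 = t^2, which means
        that \<open>t\<close> inverts \<open>y\<close>. In the second, the flippable word u t y
        inverts \<open>y\<close>, and cancelling \<open>u\<close> and a factor \<open>y\<close>
        gives the same relation.\<close>
      have tZ: "t \<otimes> y = inv y \<otimes> t" if y: "y \<in> Z" for y
        using alternative[OF y oneZ]
      proof
        assume "(t \<otimes> (y \<otimes> \<one>)) \<otimes> (t \<otimes> (y \<otimes> \<one>)) = inv u \<otimes> inv u"
        then show ?thesis using inverts_if_square_eq[OF t ZG[OF y]] t2 ZG[OF y] by simp
      next
        assume "flippable S (u \<otimes> (t \<otimes> (y \<otimes> \<one>)))"
        then have f: "flippable S (u \<otimes> (t \<otimes> y))" using ZG[OF y] by simp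
        have "t \<otimes> (y \<otimes> y) = inv y \<otimes> (t \<otimes> y)"
        proof (rule flip_inverts[OF f])
          fix c assume c: "c \<in> {\<one>, b, b \<otimes> b}"
          show "y \<otimes> c \<in> S \<and> u \<otimes> (t \<otimes> y) \<otimes> (y \<otimes> c) \<in> S"
            using words[of \<one> \<one> \<one> \<one> y c] words[of \<one> u t y y c] tT ZT uZ ZG y c cG[OF c] uG t
            by (simp add: m_assoc)
        qed (use ZG y Zb uiZ in auto)
        then show ?thesis using t ZG[OF y] by (simp flip: m_assoc)
      qed
      have "y \<otimes> z = z \<otimes> y" if yz: "y \<in> Z" "z \<in> Z" for y z
        using alternative[OF yz]
      proof
        assume "(t \<otimes> (y \<otimes> z)) \<otimes> (t \<otimes> (y \<otimes> z)) = inv u \<otimes> inv u"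
        then have "t \<otimes> (y \<otimes> z) = inv (y \<otimes> z) \<otimes> t"
          using inverts_if_square_eq[OF t] t2 ZG yz by simp
        then show ?thesis
          using inverted_product_commute[OF t ZG[OF yz(1)] ZG[OF yz(2)] tZ[OF yz(1)] tZ[OF yz(2)]] by blast
      qed (use flip_commute yz tZ in blast)
      then show False using dicyclic[OF t2n tZ] by blast
    qed
  qed
qed

section \<open>The finite set of words that rigidifies the colouring\<close>

lemma (in group) set_mult_card_le:
  assumes "finite A" "finite B"
  shows "finite (A <#> B)" "card (A <#> B) \<le> card A * card B"
proof -
  have eq: "A <#> B = (\<lambda>(x, y). x \<otimes> y) ` (A \<times> B)" by (auto simp: set_mult_def)
  show "finite (A <#> B)" using assms eq by simp
  show "card (A <#> B) \<le> card A * card B"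
    using card_image_le[of "A \<times> B" "\<lambda>(x, y). x \<otimes> y"] assms eq by (simp add: card_cartesian_product)
qed

text \<open>With b = a^2 the last factor runs through 1, a, b, b^2, b^3: \<open>a\<close> is for the
  test of normalising b, and b^3 for the case of central \<open>b\<close>. The five letters are for
  the longest word in the inverted case.\<close>

definition (in group) word_set :: "'a set \<Rightarrow> 'a \<Rightarrow> 'a set" where
  "word_set T a = T <#> (T <#> (T <#> (T <#> (T <#>
     {\<one>, a, a \<otimes> a, (a \<otimes> a) \<otimes> (a \<otimes> a), (a \<otimes> a) \<otimes> ((a \<otimes> a) \<otimes> (a \<otimes> a))}))))"

lemma (in group) word_setI:
  assumes "x \<in> T" "y \<in> T" "z \<in> T" "v \<in> T" "w \<in> T"
    "c \<in> {\<one>, a, a \<otimes> a, (a \<otimes> a) \<otimes> (a \<otimes> a), (a \<otimes> a) \<otimes> ((a \<otimes> a) \<otimes> (a \<otimes> a))}"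
  shows "x \<otimes> (y \<otimes> (z \<otimes> (v \<otimes> (w \<otimes> c)))) \<in> word_set T a"
proof -
  have mem: "p \<otimes> q \<in> A <#> B" if "p \<in> A" "q \<in> B" for p q A B
    using that by (auto simp: set_mult_def)
  show ?thesis unfolding word_set_def by (intro mem assms)
qed

lemma (in group) word_set_carrier:
  assumes "T \<subseteq> carrier G" "a \<in> carrier G"
  shows "word_set T a \<subseteq> carrier G"
  unfolding word_set_def using assms by (intro set_mult_closed) auto

lemma (in group) word_set_card:
  assumes "finite T" 
  shows "finite (word_set T a)" "card (word_set T a) \<le> 5 * card T ^ 5"
proof -
  let ?P = "{\<one>, a, a \<otimes> a, (a \<otimes> a) \<otimes> (a \<otimes> a), (a \<otimes> a) \<otimes> ((a \<otimes> a) \<otimes> (a \<otimes> a))}"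
  have P: "finite ?P" "card ?P \<le> 5"
    by (simp, intro card_insert_le_m1) simp_all
  note f = set_mult_card_le(1)[OF assms] and c = set_mult_card_le(2)[OF assms]
  show "finite (word_set T a)" unfolding word_set_def using P(1) by (intro f)
  have "card (word_set T a) \<le> card T * (card T * (card T * (card T * (card T * card ?P))))"
    unfolding word_set_def using P(1) by (meson c f mult_le_mono2 order_trans)
  also have "\<dots> \<le> card T * (card T * (card T * (card T * (card T * 5))))"
    using P(2) by (intro mult_le_mono2)
  finally show "card (word_set T a) \<le> 5 * card T ^ 5" by (simp add: power_def algebra_simps numeral_eq_Suc)
qed

lemma (in group) word_set_incl:
  assumes "T \<subseteq> carrier G" "\<one> \<in> T" "x \<in> T"
  shows "x \<in> word_set T a"
proof -
  have "\<one> \<otimes> (\<one> \<otimes> (\<one> \<otimes> (\<one> \<otimes> (x \<otimes> \<one>)))) \<in> word_set T a"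
    by (rule word_setI) (use assms in blast)+
  then show ?thesis using assms by (simp add: subset_iff)
qed

lemma (in group) generating_word_set:
  assumes T: "T \<subseteq> carrier G" "\<one> \<in> T" and a: "a \<in> carrier G"
    and Y: "Y \<subseteq> T" "generate G Y = carrier G"
  shows "generate G (word_set T a) = carrier G"
proof -
  have "Y \<subseteq> word_set T a" using word_set_incl[OF T] Y by blast
  then have "carrier G \<subseteq> generate G (word_set T a)"
    using mono_generate Y(2) by blast
  then show ?thesis
    using generate_incl word_set_carrier T a by blast
qed

text \<open>Three cases for the action of the generators on b = a^2: some generator conjugates it to
  neither b nor b^-1, or all centralise it, or all normalise it in this way and some
  \<open>t\<close> inverts it.\<close>

lemma (in group) ex_rigid_colouring:
  assumes Y: "finite Y" "Y \<subseteq> carrier G" "generate G Y = carrier G"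
    and a: "a \<in> carrier G" "(a \<otimes> a) \<otimes> (a \<otimes> a) \<noteq> \<one>"
      "((a \<otimes> a) \<otimes> (a \<otimes> a)) \<otimes> ((a \<otimes> a) \<otimes> (a \<otimes> a)) \<noteq> \<one>"
    and nc: "\<not> comm_group G" and nd: "\<not> generalized_dicyclic G"
  shows "\<exists>S. finite S \<and> S \<subseteq> carrier G \<and> card S \<le> 5 * (card Y + 2) ^ 5 \<and> generate G S = carrier G \<and>
    (\<forall>\<phi> h. colour_preserving S \<phi> \<longrightarrow> h \<in> carrier G \<longrightarrow> \<phi> h = \<phi> \<one> \<otimes> h)"
proof -
  define b where "b = a \<otimes> a"
  have b: "b \<in> carrier G" "b \<otimes> b \<noteq> \<one>" "(b \<otimes> b) \<otimes> (b \<otimes> b) \<noteq> \<one>"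
    using a unfolding b_def by auto
  \<comment> \<open>Each case is reduced to exhibiting a generating subset of \<open>T\<close>
    without flippable elements.\<close>
  have concl: ?thesis
    if T: "finite T" "T \<subseteq> carrier G" "\<one> \<in> T" "card T \<le> card Y + 2" and Z: "Z \<subseteq> T" "generate G Z = carrier G"
      and unflip: "\<And>z. z \<in> Z \<Longrightarrow> \<not> flippable (word_set T a) z" for T Z
  proof (intro exI conjI allI impI)
    show "card (word_set T a) \<le> 5 * (card Y + 2) ^ 5"
      using word_set_card(2)[OF T(1), of a] power_mono[OF T(4), of 5] by linarith
    fix \<phi> h assume "colour_preserving (word_set T a) \<phi>" "h \<in> carrier G"
    then show "\<phi> h = \<phi> \<one> \<otimes> h"
      using colour_preserving_is_translation[OF word_set_carrier[OF T(2) a(1)] _ Z(2) unflip]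
        word_set_incl[OF T(2,3)] Z(1) by blast
  qed (use word_set_card T a word_set_carrier generating_word_set Z in auto)
  have cardT: "finite (insert \<one> Y)" "card (insert \<one> Y) \<le> card Y + 2" "insert \<one> Y \<subseteq> carrier G"
    using Y card_insert_le_m1[of "card Y + 2" Y \<one>] by auto
  note wS = word_set_carrier[OF cardT(3) a(1)]
  have YT: "y \<in> word_set (insert \<one> Y) a" if "y \<in> Y" for y
    using word_set_incl[OF cardT(3)] that by blast
  have YG: "y \<in> carrier G" if "y \<in> Y" for y using that Y by auto
  consider (wild) x where "x \<in> Y" "x \<otimes> b \<noteq> b \<otimes> x" "x \<otimes> b \<noteq> inv b \<otimes> x"
    | (central) "\<forall>x \<in> Y. x \<otimes> b = b \<otimes> x"
    | (inverted) t where "t \<in> Y" "t \<otimes> b = inv b \<otimes> t" "\<forall>x \<in> Y. x \<otimes> b = b \<otimes> x \<or> x \<otimes> b = inv b \<otimes> x"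
    by blast
  then show ?thesis
  proof cases
    case wild
    show ?thesis
    proof (rule concl[OF cardT(1,3) _ cardT(2) _ Y(3)])
      fix u assume u: "u \<in> Y"
      let ?S = "word_set (insert \<one> Y) a"
      have w: "y \<otimes> (z \<otimes> c) \<in> ?S" if "y \<in> insert \<one> Y" "z \<in> insert \<one> Y" "c \<in> {\<one>, a}" for y z c
        using word_setI[of \<one> "insert \<one> Y" \<one> \<one> y z c a] that YG a(1) by auto
      show "\<not> flippable ?S u"
      proof (rule unflippable_if_not_normalised[OF wS _ YT[OF wild(1)] _ _ _ YG[OF u]])
        show "a \<in> ?S" using w[of \<one> \<one> a] a(1) by simp
        show "u \<otimes> x \<in> ?S" using w[of u x \<one>] wild(1) u YG by simp
        show "u \<otimes> x \<otimes> a \<in> ?S" using w[of u x a] wild(1) u YG a(1) by (simp add: m_assoc)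
        show "x \<otimes> a \<in> ?S" using w[of \<one> x a] wild(1) YG a(1) by simp
        show "u \<otimes> a \<in> ?S" using w[of \<one> u a] u YG a(1) by simp
      qed (use wild in \<open>simp_all add: b_def\<close>)
    qed auto
  next
    case central
    show ?thesis
    proof (rule concl[OF cardT(1,3) _ cardT(2) _ Y(3)])
      fix u assume u: "u \<in> Y"
      let ?S = "word_set (insert \<one> Y) a"
      have w: "x \<otimes> (y \<otimes> (z \<otimes> c)) \<in> ?S" 
        if "x \<in> insert \<one> Y" "y \<in> insert \<one> Y" "z \<in> insert \<one> Y" "c \<in> {\<one>, b, b \<otimes> b, b \<otimes> (b \<otimes> b)}"
        for x y z c
      proof -
        have "x \<in> carrier G" "y \<in> carrier G" "z \<in> carrier G" "c \<in> carrier G"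
          using that YG b(1) by auto
        moreover have "\<one> \<otimes> (\<one> \<otimes> (x \<otimes> (y \<otimes> (z \<otimes> c)))) \<in> ?S"
          by (rule word_setI) (use that in \<open>unfold b_def, blast+\<close>)
        ultimately show ?thesis by simp
      qed
      show "\<not> flippable ?S u"
        by (rule unflippable_if_central_square[OF wS Y(2,3) nc b _ w u]) (use central in blast)
    qed auto
  next
    case inverted
    \<comment> \<open>Multiplying by t^-1 turns the generators that invert \<open>b\<close> into
      elements that centralise it. As \<open>t\<close> is removed from \<open>Y\<close>, adjoining
      1, t and t^2 to the at most card Y - 1 elements of \<open>Z\<close> accounts for the bound
      card Y + 2.\<close>
    define f where "f x = (if x \<otimes> b = b \<otimes> x then x else inv t \<otimes> x)" for x
    define Z where "Z = f ` (Y - {t})"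
    define T where "T = {\<one>, t, t \<otimes> t} \<union> Z"
    have t: "t \<in> carrier G" using inverted YG by blast
    have fG: "f x \<in> carrier G" if "x \<in> Y" for x using that YG t unfolding f_def by auto
    have ZG: "Z \<subseteq> carrier G" unfolding Z_def using fG by auto
    have TG: "T \<subseteq> carrier G" using ZG t unfolding T_def by auto
    have cardZ: "finite Z" "card Z \<le> card Y - 1"
      unfolding Z_def using Y(1) inverted(1) card_image_le[of "Y - {t}" f] by auto
    have "card Y \<ge> 1" using inverted(1) Y(1) by (metis One_nat_def Suc_leI card_gt_0_iff empty_iff)
    moreover have "card T \<le> card {\<one>, t, t \<otimes> t} + card Z" unfolding T_def by (rule card_Un_le)
    moreover have "card {\<one>, t, t \<otimes> t} \<le> 3" by (intro card_insert_le_m1) simp_all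
    ultimately have cT: "card T \<le> card Y + 2" using cardZ by linarith
    have Zb: "z \<otimes> b = b \<otimes> z" if z: "z \<in> Z" for z
    proof -
      obtain x where x: "x \<in> Y" "z = f x" using z unfolding Z_def by blast
      show ?thesis
      proof (cases "x \<otimes> b = b \<otimes> x")
        case True
        then show ?thesis using x unfolding f_def by simp
      next
        case False
        have "inv t \<otimes> inv b = b \<otimes> inv t"
          using inverted(2) t b(1) by (metis inv_closed inv_solve_left inv_solve_right m_assoc m_closed)
        moreover have "x \<otimes> b = inv b \<otimes> x" using False inverted(3) x by blast
        ultimately have "inv t \<otimes> x \<otimes> b = b \<otimes> (inv t \<otimes> x)"
          using t b(1) YG[OF x(1)] by (metis inv_closed m_assoc)
        then show ?thesis using x False unfolding f_def by simp
      qed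
    qed
    have gen: "generate G (insert t Z) = carrier G"
    proof -
      have sub: "subgroup (generate G (insert t Z)) G"
        using ZG t by (intro generate_is_subgroup) auto
      have "Y \<subseteq> generate G (insert t Z)"
      proof
        fix x assume x: "x \<in> Y"
        show "x \<in> generate G (insert t Z)"
        proof (cases "x = t")
          case True
          then show ?thesis by (simp add: generate.incl)
        next
          case False
          then have "f x \<in> Z" using x unfolding Z_def by auto
          then have *: "f x \<in> generate G (insert t Z)" "t \<otimes> f x \<in> generate G (insert t Z)"
            by (auto intro: generate.intros)
          show ?thesis
            using * t YG[OF x] unfolding f_def by (auto split: if_splits)
        qed
      qed
      then show ?thesis
        using generate_subgroup_incl[OF _ sub] Y(3) subgroup.subset[OF sub] by blast
    qed
    show ?thesis
    proof (rule concl[OF _ TG _ cT _ gen])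
      fix u assume u: "u \<in> insert t Z"
      show "\<not> flippable (word_set T a) u"
      proof (rule unflippable_if_inverted_square[OF word_set_carrier[OF TG a(1)] t ZG gen nc nd b inverted(2) Zb _ T_def u])
        fix x y z v w c assume "x \<in> T" "y \<in> T" "z \<in> T" "v \<in> T" "w \<in> T" "c \<in> {\<one>, b, b \<otimes> b}"
        then show "x \<otimes> (y \<otimes> (z \<otimes> (v \<otimes> (w \<otimes> c)))) \<in> word_set T a"
          using word_setI[of x T y z v w c a] unfolding b_def by blast
      qed
    qed (use cardZ in \<open>auto simp: T_def\<close>)
  qed
qed

section \<open>Automorphisms preserve the cosets of a cyclic subgroup\<close>

text \<open>A uniform substitute for a lower bound on the order: an element of infinite order, for
  which \<open>ord\<close> has the value 0, satisfies it for every R.\<close>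

definition (in group) order_exceeds :: "'a \<Rightarrow> int \<Rightarrow> bool" where
  "order_exceeds a R \<longleftrightarrow> (\<forall>k::int. 0 < k \<longrightarrow> k \<le> R \<longrightarrow> a [^] k \<noteq> \<one>)"

lemma (in group) int_pow_cancel:
  fixes i j R :: int
  assumes a: "a \<in> carrier G" and ord: "order_exceeds a R"
    and eq: "a [^] i = a [^] j" and R: "\<bar>i - j\<bar> \<le> R"
  shows "i = j"
proof (rule ccontr)
  assume "i \<noteq> j"
  have "a [^] (i - j) = \<one>" "a [^] (j - i) = \<one>"
    using a eq by (simp_all add: int_pow_diff)
  moreover have "0 < i - j \<or> 0 < j - i" using \<open>i \<noteq> j\<close> by auto
  ultimately show False using ord R unfolding order_exceeds_def by (metis abs_minus_commute abs_of_pos)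
qed

lemma (in group) inv_int_pow_mult_int_pow:
  fixes i j :: int
  assumes "a \<in> carrier G"
  shows "inv (a [^] i) \<otimes> a [^] j = a [^] (j - i)"
  using assms by (simp add: int_pow_mult[symmetric] flip: int_pow_neg)

lemma (in group) inv_translate:
  fixes i j :: int
  assumes "a \<in> carrier G" "g \<in> carrier G"
  shows "inv (g \<otimes> a [^] i) \<otimes> (g \<otimes> a [^] j) = a [^] (j - i)"
  using assms by (simp add: word_simps inv_int_pow_mult_int_pow)

lemma (in group) Cayley_automorphismD:
  assumes S: "S \<subseteq> carrier G" "\<forall>s \<in> S. inv s \<in> S"
    and \<phi>: "\<phi> \<in> graph_automorphisms (Cayley_graph G S)"
  shows "bij_betw \<phi> (carrier G) (carrier G)"
    and "\<And>g h. g \<in> carrier G \<Longrightarrow> h \<in> carrier G \<Longrightarrow>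
      inv g \<otimes> h \<in> S \<longleftrightarrow> inv (\<phi> g) \<otimes> \<phi> h \<in> S"
proof -
  have "set_inv S \<subseteq> S" using S(2) by (auto simp: SET_INV_def)
  then have eq: "S \<union> set_inv S = S" by auto
  show bij: "bij_betw \<phi> (carrier G) (carrier G)"
    using \<phi> by (auto simp: graph_automorphisms_def Cayley_graph_def Bij_def)
  fix g h assume gh: "g \<in> carrier G" "h \<in> carrier G"
  moreover have "\<phi> g \<in> carrier G" "\<phi> h \<in> carrier G" using bij gh by (auto dest: bij_betwE)
  ultimately show "inv g \<otimes> h \<in> S \<longleftrightarrow> inv (\<phi> g) \<otimes> \<phi> h \<in> S"
    using \<phi> by (simp add: graph_automorphisms_def Cayley_graph_def eq)
qed

lemma (in group) translate_preimage:
  assumes "g \<in> carrier G" "B \<subseteq> carrier G"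
  shows "{k \<in> carrier G. inv g \<otimes> k \<in> B} = (\<lambda>x. g \<otimes> x) ` B"
proof -
  have "k \<in> (\<lambda>x. g \<otimes> x) ` B" if "k \<in> carrier G" "inv g \<otimes> k \<in> B" for k
    using that assms by (intro image_eqI[of _ _ "inv g \<otimes> k"]) auto
  then show ?thesis using assms by auto
qed

text \<open>Automorphisms preserve the number of common neighbours of two vertices. The value m = 2
  |B| + 2 gives an A-edge at least m - 1 = 2 |B| + 1 of them, one more than a B-edge can
  have.\<close>

lemma (in group) Cayley_automorphism_preserves_cosets:
  fixes m :: int
  assumes a: "a \<in> carrier G" and B: "finite B" "B \<subseteq> carrier G" "\<forall>x \<in> B. inv x \<in> B"
    and aB: "\<And>i::int. a [^] i \<notin> B"
    and m: "m = 2 * int (card B) + 2"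
    and ord: "order_exceeds a (4 * m)"
    and A: "A = {a [^] i | i::int. i \<noteq> 0 \<and> \<bar>i\<bar> \<le> m}"
    and \<phi>: "\<phi> \<in> graph_automorphisms (Cayley_graph G (A \<union> B))"
    and gh: "g \<in> carrier G" "h \<in> carrier G"
  shows "inv g \<otimes> h \<in> A \<longleftrightarrow> inv (\<phi> g) \<otimes> \<phi> h \<in> A"
    and "inv g \<otimes> h \<in> B \<longleftrightarrow> inv (\<phi> g) \<otimes> \<phi> h \<in> B"
proof -
  have invA: "inv x \<in> A" if x: "x \<in> A" for x
  proof -
    obtain i :: int where "x = a [^] i" "i \<noteq> 0" "\<bar>i\<bar> \<le> m" using x unfolding A by blast
    then show ?thesis unfolding A using a by (intro CollectI exI[of _ "-i"]) (simp add: int_pow_neg)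
  qed
  have memA: "a [^] i \<in> A" if "i \<noteq> 0" "\<bar>i\<bar> \<le> m" for i :: int
    using that unfolding A by blast
  have S: "A \<union> B \<subseteq> carrier G" using a B unfolding A by auto
  have Sinv: "\<forall>x \<in> A \<union> B. inv x \<in> A \<union> B" using invA B by auto
  note bij = Cayley_automorphismD(1)[OF S Sinv \<phi>] and adj = Cayley_automorphismD(2)[OF S Sinv \<phi>]
  have \<phi>G: "\<phi> x \<in> carrier G" if "x \<in> carrier G" for x using bij that by (auto dest: bij_betwE)
  define N where "N g h = {k \<in> carrier G. inv g \<otimes> k \<in> A \<union> B \<and> inv h \<otimes> k \<in> A \<union> B}" for g h
  have disj: "A \<inter> B = {}" using aB unfolding A by auto
  have cardN: "card (N (\<phi> g) (\<phi> h)) = card (N g h)" if gh: "g \<in> carrier G" "h \<in> carrier G" for g h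
  proof -
    have "\<phi> ` N g h = N (\<phi> g) (\<phi> h)"
    proof
      show "\<phi> ` N g h \<subseteq> N (\<phi> g) (\<phi> h)" unfolding N_def using adj gh \<phi>G by auto
      show "N (\<phi> g) (\<phi> h) \<subseteq> \<phi> ` N g h"
      proof
        fix k assume k: "k \<in> N (\<phi> g) (\<phi> h)"
        then have "k \<in> \<phi> ` carrier G" using bij unfolding N_def bij_betw_def by auto
        then obtain l where "l \<in> carrier G" "k = \<phi> l" by blast
        then show "k \<in> \<phi> ` N g h" using k adj gh unfolding N_def by auto
      qed
    qed
    moreover have "inj_on \<phi> (N g h)"
      using bij unfolding N_def bij_betw_def by (auto intro: inj_on_subset)
    ultimately show ?thesis by (metis card_image)
  qed
  have B_small: "card (N g h) \<le> 2 * card B"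
    if gh: "g \<in> carrier G" "h \<in> carrier G" "inv g \<otimes> h \<in> B" for g h
  proof -
    have "N g h \<subseteq> (\<lambda>x. g \<otimes> x) ` B \<union> (\<lambda>x. h \<otimes> x) ` B"
    proof
      fix k assume k: "k \<in> N g h"
      then have kG: "k \<in> carrier G" unfolding N_def by simp
      \<comment> \<open>Two A-edges g k and h k would put g^-1 h into the cyclic group of
        \<open>a\<close>. So every common neighbour lies in g B or in h B.\<close>
      have "inv g \<otimes> k \<in> B \<or> inv h \<otimes> k \<in> B"
      proof (rule ccontr)
        assume "\<not> ?thesis"
        then have "inv g \<otimes> k \<in> A" "inv h \<otimes> k \<in> A" using k unfolding N_def by auto
        then obtain i j :: int where ij: "inv g \<otimes> k = a [^] i" "inv h \<otimes> k = a [^] j"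
          unfolding A by blast
        have "inv g \<otimes> h = (inv g \<otimes> k) \<otimes> inv (inv h \<otimes> k)"
          using gh kG by (simp add: word_simps)
        also have "\<dots> = a [^] (i - j)" using a ij by (simp add: int_pow_diff)
        finally show False using gh(3) aB by simp
      qed
      then show "k \<in> (\<lambda>x. g \<otimes> x) ` B \<union> (\<lambda>x. h \<otimes> x) ` B"
        using kG translate_preimage gh(1,2) B(2) by blast
    qed
    then have "card (N g h) \<le> card ((\<lambda>x. g \<otimes> x) ` B \<union> (\<lambda>x. h \<otimes> x) ` B)"
      using B(1) by (intro card_mono) auto
    also have "\<dots> \<le> card ((\<lambda>x. g \<otimes> x) ` B) + card ((\<lambda>x. h \<otimes> x) ` B)" by (rule card_Un_le)
    also have "\<dots> \<le> card B + card B" using B(1) by (intro add_mono card_image_le)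
    finally show ?thesis by simp
  qed
  have A_big: "2 * card B < card (N g h)"
    if gh: "g \<in> carrier G" "h \<in> carrier G" "inv g \<otimes> h \<in> A" for g h
  proof -
    obtain k :: int where k: "inv g \<otimes> h = a [^] k" "k \<noteq> 0" "\<bar>k\<bar> \<le> m" using gh(3) unfolding A by blast
    have h: "h = g \<otimes> a [^] k" using gh by (simp flip: k(1))
    \<comment> \<open>These are the points on the line through \<open>g\<close> at distance 1 to m
      from \<open>g\<close>, on the side of \<open>h\<close>, with \<open>h\<close> itself removed.
      Their distance from \<open>h\<close> is then between 1 and m - 1.\<close>
    define I where "I = {1..m} - {\<bar>k\<bar>}"
    define f where "f i = g \<otimes> a [^] (sgn k * i)" for i
    have "inj_on f I"
    proof (rule inj_onI)
      fix i j assume ij: "i \<in> I" "j \<in> I" "f i = f j"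
      then have "a [^] (sgn k * i) = a [^] (sgn k * j)" using gh a unfolding f_def by simp
      moreover have "\<bar>sgn k * i - sgn k * j\<bar> \<le> 4 * m"
        using ij(1,2) k(2) unfolding I_def by (auto simp: sgn_if)
      ultimately have "sgn k * i = sgn k * j" using int_pow_cancel[OF a ord] by blast
      then show "i = j" using k(2) by (auto simp: sgn_if split: if_splits)
    qed
    moreover have "f ` I \<subseteq> N g h"
    proof
      fix x assume "x \<in> f ` I"
      then obtain i where i: "i \<in> I" "x = f i" by blast
      have "inv (g \<otimes> a [^] (0::int)) \<otimes> x \<in> A"
        unfolding i f_def inv_translate[OF a gh(1)]
        by (rule memA) (use i(1) k in \<open>auto simp: I_def sgn_if\<close>)
      moreover have "inv h \<otimes> x \<in> A"
        unfolding i f_def h inv_translate[OF a gh(1)]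
        by (rule memA) (use i(1) k in \<open>auto simp: I_def sgn_if\<close>)
      ultimately show "x \<in> N g h" using gh a unfolding N_def i f_def by simp
    qed
    moreover have "finite (N g h)"
    proof -
      have "A \<subseteq> (\<lambda>i. a [^] i) ` {-m..m}" unfolding A by (auto simp: abs_le_iff intro!: imageI)
      then have "finite A" using finite_subset by blast
      then have "finite ((\<lambda>x. g \<otimes> x) ` (A \<union> B))" using B by simp
      moreover have "N g h \<subseteq> (\<lambda>x. g \<otimes> x) ` (A \<union> B)"
        using translate_preimage[OF gh(1) S] unfolding N_def by auto
      ultimately show ?thesis by (rule rev_finite_subset)
    qed
    ultimately have "card I \<le> card (N g h)" by (metis card_image card_mono)
    moreover have "card I = nat m - 1" unfolding I_def using k by (subst card_Diff_singleton) auto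
    ultimately show ?thesis using m by linarith
  qed
  have imp: "inv (\<phi> g) \<otimes> \<phi> h \<in> A" if "inv g \<otimes> h \<in> A" 
    using adj[OF gh] that A_big[OF gh that] B_small[of "\<phi> g" "\<phi> h"] cardN[OF gh] \<phi>G gh by auto
  have imp': "inv (\<phi> g) \<otimes> \<phi> h \<in> B" if "inv g \<otimes> h \<in> B" 
    using adj[OF gh] that B_small[OF gh that] A_big[of "\<phi> g" "\<phi> h"] cardN[OF gh] \<phi>G gh by auto
  show "inv g \<otimes> h \<in> A \<longleftrightarrow> inv (\<phi> g) \<otimes> \<phi> h \<in> A" "inv g \<otimes> h \<in> B \<longleftrightarrow> inv (\<phi> g) \<otimes> \<phi> h \<in> B"
    using imp imp' adj[OF gh] disj by auto
qed

text \<open>Think of \<open>A0\<close> as a ball of radius m on a line. The ball around g minus the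
  ball around g a is the single point g a^-m, whereas for an image at offset k with |k| \<ge> 2 the
  corresponding difference contains at least two points.\<close>

lemma (in group) interval_automorphism_step:
  fixes m :: int
  assumes a: "a \<in> carrier G" and m: "2 \<le> m"
    and ord: "order_exceeds a (4 * m)"
    and A: "A = {a [^] i | i::int. i \<noteq> 0 \<and> \<bar>i\<bar> \<le> m}"
    and bij: "bij_betw \<phi> (carrier G) (carrier G)"
    and adj: "\<And>g h. g \<in> carrier G \<Longrightarrow> h \<in> carrier G \<Longrightarrow> inv g \<otimes> h \<in> A \<longleftrightarrow> inv (\<phi> g) \<otimes> \<phi> h \<in> A"
    and g: "g \<in> carrier G"
  shows "\<phi> (g \<otimes> a) = \<phi> g \<otimes> a \<or> \<phi> (g \<otimes> a) = \<phi> g \<otimes> inv a"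
proof -
  have \<phi>G: "\<phi> x \<in> carrier G" if "x \<in> carrier G" for x using bij that by (auto dest: bij_betwE)
  define A0 where "A0 = {a [^] i | i::int. \<bar>i\<bar> \<le> m}"
  have A0: "A0 = insert \<one> A"
    unfolding A0_def A using m by (auto intro: exI[of _ "0::int"])
  have one: "inv x \<otimes> y = \<one> \<longleftrightarrow> x = y" if "x \<in> carrier G" "y \<in> carrier G" for x y
    using that by (metis cancel_left(1) l_inv r_one inv_closed)
  have adj0: "inv x \<otimes> y \<in> A0 \<longleftrightarrow> inv (\<phi> x) \<otimes> \<phi> y \<in> A0" if "x \<in> carrier G" "y \<in> carrier G" for x y
  proof -
    have "x = y \<longleftrightarrow> \<phi> x = \<phi> y" using bij that unfolding bij_betw_def inj_on_def by blast
    then show ?thesis using adj[OF that] one that \<phi>G unfolding A0 by auto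
  qed
  \<comment> \<open>The order bound 4 m is used here: it compares an exponent of size at most 3 m
    with one of size at most m.\<close>
  have mem: "a [^] i \<in> A0 \<longleftrightarrow> \<bar>i\<bar> \<le> m" if i: "\<bar>i\<bar> \<le> 3 * m" for i
  proof
    assume "a [^] i \<in> A0"
    then obtain j :: int where j: "a [^] i = a [^] j" "\<bar>j\<bar> \<le> m" unfolding A0_def by blast
    then have "i = j" using int_pow_cancel[OF a ord j(1)] i by linarith
    then show "\<bar>i\<bar> \<le> m" using j by simp
  qed (auto simp: A0_def)
  have "inv g \<otimes> (g \<otimes> a) \<in> A"
    using g a m unfolding A by (auto intro!: exI[of _ "1::int"])
  then have "inv (\<phi> g) \<otimes> \<phi> (g \<otimes> a) \<in> A" using adj[of g "g \<otimes> a"] g a by simp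
  then obtain k :: int where k: "inv (\<phi> g) \<otimes> \<phi> (g \<otimes> a) = a [^] k" "k \<noteq> 0" "\<bar>k\<bar> \<le> m"
    unfolding A by blast
  have \<phi>ga: "\<phi> (g \<otimes> a) = \<phi> g \<otimes> a [^] k" using \<phi>G g a by (simp flip: k(1))
  have "\<bar>k\<bar> = 1"
  proof (rule ccontr)
    assume "\<bar>k\<bar> \<noteq> 1"
    then have k2: "\<bar>k\<bar> \<ge> 2" using k by auto
    \<comment> \<open>The choices d = 0 and d = 1 give two points of the difference, at offsets m
      and m - 1 from \<phi>(g) on the side opposite to \<phi>(g a); both have preimage g
      a^-m.\<close>
    have unique: "u = g \<otimes> a [^] (- m)"
      if u: "u \<in> carrier G" "\<phi> u = \<phi> g \<otimes> a [^] (- sgn k * (m - d))" and d: "d \<in> {0, 1}" for u d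
    proof -
      have "inv (\<phi> g \<otimes> a [^] (0::int)) \<otimes> \<phi> u \<in> A0"
        unfolding u inv_translate[OF a \<phi>G[OF g]] using m d mem by (subst mem) (auto simp: sgn_if)
      then have 1: "inv g \<otimes> u \<in> A0" using adj0 g u \<phi>G by simp
      have "inv (\<phi> (g \<otimes> a)) \<otimes> \<phi> u \<notin> A0"
        unfolding \<phi>ga u inv_translate[OF a \<phi>G[OF g]] using m d k k2 by (subst mem) (auto simp: sgn_if)
      then have 2: "inv (g \<otimes> a [^] (1::int)) \<otimes> u \<notin> A0" using adj0 g u a by simp
      obtain i :: int where i: "inv g \<otimes> u = a [^] i" "\<bar>i\<bar> \<le> m" using 1 unfolding A0_def by blast
      have ui: "u = g \<otimes> a [^] i" using g u by (simp flip: i(1))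
      have "a [^] (i - 1) \<notin> A0" using 2 unfolding ui inv_translate[OF a g] .
      then have "i = - m" using i m by (subst (asm) mem) auto
      then show ?thesis using ui by simp
    qed
    have pre: "\<exists>u \<in> carrier G. \<phi> u = v" if "v \<in> carrier G" for v
      using bij that unfolding bij_betw_def by (metis imageE)
    obtain u v where uv: "u \<in> carrier G" "\<phi> u = \<phi> g \<otimes> a [^] (- sgn k * (m - 0))"
      "v \<in> carrier G" "\<phi> v = \<phi> g \<otimes> a [^] (- sgn k * (m - 1))"
      using pre[of "\<phi> g \<otimes> a [^] (- sgn k * (m - 0))"] pre[of "\<phi> g \<otimes> a [^] (- sgn k * (m - 1))"]
        \<phi>G[OF g] a by auto
    then have "u = v" using unique[of u 0] unique[of v 1] by simp
    then have "a [^] (- sgn k * (m - 0)) = a [^] (- sgn k * (m - 1))"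
      using uv \<phi>G[OF g] a by simp
    moreover have "\<bar>- sgn k * (m - 0) - (- sgn k * (m - 1))\<bar> \<le> 4 * m"
      using m k by (auto simp: sgn_if)
    ultimately have "- sgn k * (m - 0) = - sgn k * (m - 1)"
      by (rule int_pow_cancel[OF a ord])
    then show False using k by (auto simp: sgn_if split: if_splits)
  qed
  then have "k = 1 \<or> k = -1" by auto
  then show ?thesis using \<phi>ga a by (auto simp: int_pow_neg)
qed

text \<open>The direction chosen at the first step persists along the whole line: turning back after
  one step would give \<phi>(h a^2) = \<phi>(h), against injectivity and a^2 \<noteq> 1.\<close>

lemma (in group) line_isometry:
  assumes a: "a \<in> carrier G" "a \<otimes> a \<noteq> \<one>"
    and bij: "bij_betw \<phi> (carrier G) (carrier G)"
    and step: "\<And>g. g \<in> carrier G \<Longrightarrow> \<phi> (g \<otimes> a) = \<phi> g \<otimes> a \<or> \<phi> (g \<otimes> a) = \<phi> g \<otimes> inv a"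
    and g: "g \<in> carrier G"
  shows "(\<forall>i::int. \<phi> (g \<otimes> a [^] i) = \<phi> g \<otimes> a [^] i) \<or> (\<forall>i::int. \<phi> (g \<otimes> a [^] i) = \<phi> g \<otimes> inv (a [^] i))"
proof -
  have \<phi>G: "\<phi> x \<in> carrier G" if "x \<in> carrier G" for x using bij that by (auto dest: bij_betwE)
  have *: "\<forall>i::int. \<phi> (g \<otimes> a [^] i) = \<phi> g \<otimes> c [^] i"
    if c: "c \<in> {a, inv a}" "\<phi> (g \<otimes> a) = \<phi> g \<otimes> c" for c
  proof -
    have cG: "c \<in> carrier G" using c a by auto
    define P where "P h \<longleftrightarrow> \<phi> (h \<otimes> a) = \<phi> h \<otimes> c" for h
    have turn: "P h \<longleftrightarrow> P (h \<otimes> a)" if h: "h \<in> carrier G" for h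
    proof -
      have "h \<otimes> a \<otimes> a \<noteq> h" using h a by (simp add: m_assoc)
      then have neq: "\<phi> (h \<otimes> a \<otimes> a) \<noteq> \<phi> h"
        using bij h a unfolding bij_betw_def inj_on_def by (metis m_closed)
      have s: "\<phi> (x \<otimes> a) = \<phi> x \<otimes> c \<or> \<phi> (x \<otimes> a) = \<phi> x \<otimes> inv c" if "x \<in> carrier G" for x
        using step[OF that] c(1) a(1) by (elim insertE) auto
      have "\<phi> (h \<otimes> a \<otimes> a) = \<phi> h" if "P h \<noteq> P (h \<otimes> a)"
      proof (cases "P h")
        case True
        then have "\<phi> (h \<otimes> a \<otimes> a) = \<phi> h \<otimes> c \<otimes> inv c"
          using that s[of "h \<otimes> a"] h a(1) unfolding P_def by simp
        then show ?thesis using h cG \<phi>G by (simp add: m_assoc)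
      next
        case False
        then have "\<phi> (h \<otimes> a \<otimes> a) = \<phi> h \<otimes> inv c \<otimes> c"
          using that s[OF h] unfolding P_def by simp
        then show ?thesis using h cG \<phi>G by (simp add: m_assoc)
      qed
      then show ?thesis using neq by blast
    qed
    have P: "P (g \<otimes> a [^] i)" for i :: int
    proof (induction i rule: int_induct[of _ 0])
      case base
      then show ?case using c g unfolding P_def by simp
    next
      case (step1 i)
      then show ?case using turn[of "g \<otimes> a [^] i"] g a by (simp add: m_assoc int_pow_mult)
    next
      case (step2 i)
      have "g \<otimes> a [^] (i - 1) \<otimes> a = g \<otimes> a [^] i" using g a by (simp add: m_assoc int_pow_diff)
      then show ?case using turn[of "g \<otimes> a [^] (i - 1)"] step2 g a by simp
    qed
    show ?thesis
    proof
      fix i :: int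
      show "\<phi> (g \<otimes> a [^] i) = \<phi> g \<otimes> c [^] i"
      proof (induction i rule: int_induct[of _ 0])
        case base
        then show ?case using g \<phi>G by simp
      next
        case (step1 i)
        then show ?case using P[of i] g a cG \<phi>G unfolding P_def by (simp add: m_assoc int_pow_mult)
      next
        case (step2 i)
        have "g \<otimes> a [^] (i - 1) \<otimes> a = g \<otimes> a [^] i" using g a by (simp add: m_assoc int_pow_diff)
        then have "\<phi> g \<otimes> c [^] i = \<phi> (g \<otimes> a [^] (i - 1)) \<otimes> c"
          using P[of "i - 1"] step2 unfolding P_def by simp
        then have "\<phi> g \<otimes> c [^] i \<otimes> inv c = \<phi> (g \<otimes> a [^] (i - 1))"
          using g a cG \<phi>G by (simp add: m_assoc)
        then show ?case using g cG \<phi>G by (simp add: m_assoc int_pow_diff)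
      qed
    qed
  qed
  from step[OF g] show ?thesis
    using *[of a] *[of "inv a"] a by (auto simp: int_pow_inv)
qed

section \<open>Generic powers\<close>

text \<open>In the applications \<open>q\<close> is a power of \<open>a\<close>, and
  \<open>p\<close> is \<open>q\<close> or its inverse: p x q = x then says that \<open>x\<close>
  inverts \<open>q\<close>, respectively centralises it.\<close>

lemma (in group) int_pow_sandwich:
  fixes i :: int
  assumes G: "p \<in> carrier G" "q \<in> carrier G" "x \<in> carrier G" and eq: "p \<otimes> (x \<otimes> q) = x"
  shows "p [^] i \<otimes> (x \<otimes> q [^] i) = x"
proof (induction i rule: int_induct[of _ 0])
  case base
  then show ?case using G by simp
next
  case (step1 i)
  have "p [^] (i + 1) = p [^] i \<otimes> p" "q [^] (i + 1) = q \<otimes> q [^] i"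
    using G int_pow_mult[of p i 1] int_pow_mult[of q 1 i] by (simp_all add: add.commute)
  then have "p [^] (i + 1) \<otimes> (x \<otimes> q [^] (i + 1)) = p [^] i \<otimes> ((p \<otimes> (x \<otimes> q)) \<otimes> q [^] i)"
    using G by (simp add: m_assoc)
  then show ?case using step1 by (simp only: eq)
next
  case (step2 i)
  have "inv p \<otimes> (p \<otimes> (x \<otimes> q)) \<otimes> inv q = inv p \<otimes> x \<otimes> inv q" by (simp only: eq)
  then have eq': "inv p \<otimes> (x \<otimes> inv q) = x" using G by (simp add: m_assoc)
  have "p [^] (i - 1) = p [^] i \<otimes> inv p" "q [^] (i - 1) = inv q \<otimes> q [^] i"
    using G int_pow_diff[of p i 1] int_pow_mult[of q "-1" i] by (simp_all add: int_pow_neg)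
  then have "p [^] (i - 1) \<otimes> (x \<otimes> q [^] (i - 1)) = p [^] i \<otimes> ((inv p \<otimes> (x \<otimes> inv q)) \<otimes> q [^] i)"
    using G by (simp add: m_assoc)
  then show ?case using step2 by (simp only: eq')
qed

lemma (in group) int_pow_sandwich_eqD:
  fixes i j :: int
  assumes G: "p \<in> carrier G" "q \<in> carrier G" "x \<in> carrier G"
    and eq: "p [^] i \<otimes> (x \<otimes> q [^] i) = p [^] j \<otimes> (x \<otimes> q [^] j)"
  shows "p [^] (j - i) \<otimes> (x \<otimes> q [^] (j - i)) = x"
proof -
  have "p [^] (j - i) \<otimes> (x \<otimes> q [^] (j - i)) = inv (p [^] i) \<otimes> (p [^] j \<otimes> (x \<otimes> q [^] j)) \<otimes> inv (q [^] i)"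
  proof -
    have "p [^] (j - i) = inv (p [^] i) \<otimes> p [^] j" using G inv_int_pow_mult_int_pow by simp
    moreover have "q [^] (j - i) = q [^] j \<otimes> inv (q [^] i)" using G int_pow_diff by simp
    ultimately show ?thesis using G by (simp add: m_assoc)
  qed
  also have "\<dots> = inv (p [^] i) \<otimes> (p [^] i \<otimes> (x \<otimes> q [^] i)) \<otimes> inv (q [^] i)" by (simp only: eq)
  also have "\<dots> = x" using G by (simp add: m_assoc)
  finally show ?thesis .
qed

text \<open>The hypotheses say that \<open>x\<close> both inverts and centralises
  \<open>c\<close>.\<close>

lemma (in group) sandwich_both:
  assumes G: "c \<in> carrier G" "x \<in> carrier G"
    and 1: "c \<otimes> (x \<otimes> c) = x" and 2: "inv c \<otimes> (x \<otimes> c) = x"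
  shows "c \<otimes> c = \<one>"
proof -
  have "x \<otimes> c = c \<otimes> x" using 2 G by (metis cancel_left(1) m_closed)
  then have "c \<otimes> c \<otimes> x = x" using 1 G by (simp add: m_assoc)
  then have "c \<otimes> c \<otimes> x \<otimes> inv x = x \<otimes> inv x" by simp
  then show ?thesis using G by (simp add: m_assoc)
qed

text \<open>The maps \<open>i \<mapsto> a\<^sup>i x a\<^sup>i\<close> and \<open>i \<mapsto> a\<^sup>-\<^sup>i x a\<^sup>i\<close> can have many coincidences when \<open>x\<close> normalises
  a small power of \<open>a\<close>. Passing to exponents divisible by such a power \<open>d\<close> makes one of them constant;
  the other one is then injective because otherwise \<open>a\<^sup>2\<^sup>d\<^sup>i = 1\<close> for some small \<open>i\<close>.\<close>

lemma (in group) ex_sandwich_scale: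
  fixes D :: int
  assumes a: "a \<in> carrier G" and x: "x \<in> carrier G" and D: "0 < D"
    and ord: "order_exceeds a (2 * D * D)"
  shows "\<exists>d. 1 \<le> d \<and> d \<le> D \<and>
    ((\<forall>i::int. (a [^] d) [^] i \<otimes> (x \<otimes> (a [^] d) [^] i) = x) \<or>
      inj_on (\<lambda>i. (a [^] d) [^] i \<otimes> (x \<otimes> (a [^] d) [^] i)) {1..D}) \<and>
    ((\<forall>i::int. inv (a [^] d) [^] i \<otimes> (x \<otimes> (a [^] d) [^] i) = x) \<or>
      inj_on (\<lambda>i. inv (a [^] d) [^] i \<otimes> (x \<otimes> (a [^] d) [^] i)) {1..D})"
proof -
  \<comment> \<open>If one map is constant, a coincidence of the other gives c^2 = 1 with c = a^(d
    (j - i)). The exponent 2 d (j - i) is at most 2 D^2 in absolute value, whence the order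
    bound.\<close>
  have small: "i = j"
    if d: "1 \<le> d" "d \<le> D" and ij: "i \<in> {1..D}" "j \<in> {1..D}"
      and 1: "(a [^] d) [^] (j - i) \<otimes> (x \<otimes> (a [^] d) [^] (j - i)) = x"
      and 2: "inv (a [^] d) [^] (j - i) \<otimes> (x \<otimes> (a [^] d) [^] (j - i)) = x" for d i j :: int
  proof -
    let ?c = "(a [^] d) [^] (j - i)"
    have "?c \<otimes> ?c = \<one>"
      using sandwich_both[of ?c x] 1 2 a x by (simp add: int_pow_inv)
    then have "a [^] (d * (j - i) + d * (j - i)) = a [^] (0::int)"
      using a by (simp add: int_pow_pow flip: int_pow_mult)
    moreover have "\<bar>d * (j - i) + d * (j - i) - 0\<bar> \<le> 2 * D * D"
    proof -
      have "\<bar>d\<bar> * \<bar>j - i\<bar> \<le> D * D" using d ij by (intro mult_mono) auto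
      then show ?thesis by (simp add: abs_mult[symmetric] algebra_simps) 
    qed
    ultimately have "d * (j - i) + d * (j - i) = 0" by (rule int_pow_cancel[OF a ord])
    then show "i = j" using d by (simp add: mult_2[symmetric])
  qed
  consider (inv) d where "1 \<le> d" "d \<le> D" "a [^] d \<otimes> (x \<otimes> a [^] d) = x"
    | (com) d where "1 \<le> d" "d \<le> D" "inv (a [^] d) \<otimes> (x \<otimes> a [^] d) = x"
    | (none) "\<And>d::int. 1 \<le> d \<Longrightarrow> d \<le> D \<Longrightarrow> a [^] d \<otimes> (x \<otimes> a [^] d) \<noteq> x"
        "\<And>d::int. 1 \<le> d \<Longrightarrow> d \<le> D \<Longrightarrow> inv (a [^] d) \<otimes> (x \<otimes> a [^] d) \<noteq> x"
    by blast
  then show ?thesis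
  proof cases
    case inv
    have const: "(a [^] d) [^] i \<otimes> (x \<otimes> (a [^] d) [^] i) = x" for i :: int
      by (rule int_pow_sandwich[OF _ _ x inv(3)]) (use a in auto)
    have "inj_on (\<lambda>i. inv (a [^] d) [^] i \<otimes> (x \<otimes> (a [^] d) [^] i)) {1..D}"
      by (intro inj_onI, rule small[OF inv(1,2) _ _ const], assumption+, rule int_pow_sandwich_eqD)
        (use a x in auto)
    then show ?thesis using inv const by blast
  next
    case com
    have const: "inv (a [^] d) [^] i \<otimes> (x \<otimes> (a [^] d) [^] i) = x" for i :: int
      by (rule int_pow_sandwich[OF _ _ x com(3)]) (use a in auto)
    have "inj_on (\<lambda>i. (a [^] d) [^] i \<otimes> (x \<otimes> (a [^] d) [^] i)) {1..D}"
      by (intro inj_onI, rule small[OF com(1,2) _ _ _ const], assumption+, rule int_pow_sandwich_eqD)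
        (use a x in auto)
    then show ?thesis using com const by blast
  next
    case none
    \<comment> \<open>With no normalised power up to D the scale d = 1 works: a coincidence at i < j
      would normalise the power with exponent j - i < D.\<close>
    let ?f = "\<lambda>p i. p [^] (i::int) \<otimes> (x \<otimes> (a [^] (1::int)) [^] i)"
    have "inj_on (?f p) {1..D}"
      if p: "p \<in> carrier G" "\<And>d::int. 1 \<le> d \<Longrightarrow> d \<le> D \<Longrightarrow> p [^] d \<otimes> (x \<otimes> a [^] d) \<noteq> x" for p
    proof (rule linorder_inj_onI)
      fix i j assume ij: "i < j" "i \<in> {1..D}" "j \<in> {1..D}"
      show "?f p i \<noteq> ?f p j"
      proof
        assume "?f p i = ?f p j"
        then have "p [^] (j - i) \<otimes> (x \<otimes> a [^] (j - i)) = x"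
          using int_pow_sandwich_eqD[of p a x i j] p(1) a x by simp
        then show False using p(2)[of "j - i"] ij by auto
      qed
    qed auto
    from this[of a] this[of "inv a"] none a D show ?thesis
      by (intro exI[of _ "1::int"]) (simp add: int_pow_inv)
  qed
qed

lemma card_filter_mem_le:
  assumes "finite V" "inj_on f J \<or> (\<forall>i \<in> J. f i \<notin> V)"
  shows "card {i \<in> J. f i \<in> V} \<le> card V"
  using assms(2)
proof
  assume "inj_on f J"
  then have "inj_on f {i \<in> J. f i \<in> V}" by (auto intro: inj_on_subset)
  then show ?thesis using assms(1) by (intro card_inj_on_le) auto
next
  assume "\<forall>i \<in> J. f i \<notin> V"
  then have "{i \<in> J. f i \<in> V} = {}" by auto
  then show ?thesis by (simp only: card.empty)
qed

text \<open>A counting argument over D exponents. After rescaling, each of the five expressions in c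
  is injective or constantly x, and x is outside \<open>V4\<close> and \<open>V5\<close>; so each
  condition spoils at most as many exponents as its forbidden set has elements. \<open>V2\<close>
  counts twice, for c and for c^2.\<close>

lemma (in group) ex_avoiding_power:
  fixes D :: nat
  assumes a: "a \<in> carrier G" and x: "x \<in> carrier G"
    and ord: "order_exceeds a (2 * int D * int D)"
    and fin: "finite V1" "finite V2" "finite V4" "finite V5"
    and xV: "x \<notin> V4" "x \<notin> V5"
    and D: "card V1 + 2 * card V2 + card V4 + card V5 < D"
  shows "\<exists>i::int. let c = a [^] i in x \<otimes> c \<notin> V1 \<and> c \<notin> V2 \<and> c \<otimes> c \<notin> V2 \<and>
    c \<otimes> (x \<otimes> c) \<notin> V4 \<and> inv c \<otimes> (x \<otimes> c) \<notin> V5"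
proof -
  have D0: "0 < int D" using D by simp
  obtain d where d: "1 \<le> d" "d \<le> int D" and
    f4: "(\<forall>i::int. (a [^] d) [^] i \<otimes> (x \<otimes> (a [^] d) [^] i) = x) \<or>
      inj_on (\<lambda>i. (a [^] d) [^] i \<otimes> (x \<otimes> (a [^] d) [^] i)) {1..int D}" and
    f5: "(\<forall>i::int. inv (a [^] d) [^] i \<otimes> (x \<otimes> (a [^] d) [^] i) = x) \<or>
      inj_on (\<lambda>i. inv (a [^] d) [^] i \<otimes> (x \<otimes> (a [^] d) [^] i)) {1..int D}"
    using ex_sandwich_scale[OF a x D0] ord by blast
  define c where "c i = (a [^] d) [^] i" for i :: int
  define J where "J = {1..int D}"
  have cG: "c i \<in> carrier G" for i using a unfolding c_def by simp
  have sq: "inj_on (\<lambda>i. c i \<otimes> c i) J"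
  proof (rule inj_onI)
    fix i j assume ij: "i \<in> J" "j \<in> J" "c i \<otimes> c i = c j \<otimes> c j"
    then have "a [^] (d * i + d * i) = a [^] (d * j + d * j)"
      using a unfolding c_def by (simp add: int_pow_pow flip: int_pow_mult)
    moreover have "\<bar>d * i + d * i - (d * j + d * j)\<bar> \<le> 2 * int D * int D"
    proof -
      have "\<bar>d\<bar> * \<bar>i - j\<bar> \<le> int D * int D" using d ij(1,2) unfolding J_def by (intro mult_mono) auto
      then show ?thesis by (simp add: abs_mult[symmetric] algebra_simps)
    qed
    ultimately have "d * i + d * i = d * j + d * j" by (rule int_pow_cancel[OF a ord])
    then show "i = j" using d by (simp add: mult_2[symmetric])
  qed
  then have inj: "inj_on c J" unfolding inj_on_def by metis
  then have injx: "inj_on (\<lambda>i. x \<otimes> c i) J" using cG x by (auto simp: inj_on_def)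
  define F1 F2 F3 F4 F5 where "F1 = {i \<in> J. x \<otimes> c i \<in> V1}" and "F2 = {i \<in> J. c i \<in> V2}"
    and "F3 = {i \<in> J. c i \<otimes> c i \<in> V2}" and "F4 = {i \<in> J. c i \<otimes> (x \<otimes> c i) \<in> V4}"
    and "F5 = {i \<in> J. inv (c i) \<otimes> (x \<otimes> c i) \<in> V5}"
  have "card F1 \<le> card V1" "card F2 \<le> card V2" "card F3 \<le> card V2"
    unfolding F1_def F2_def F3_def using card_filter_mem_le[of V1 "\<lambda>i. x \<otimes> c i" J]
      card_filter_mem_le[of V2 c J] card_filter_mem_le[of V2 "\<lambda>i. c i \<otimes> c i" J] fin inj injx sq
    by simp_all
  moreover have "card F4 \<le> card V4"
    unfolding F4_def c_def J_def using f4 xV(1) by (intro card_filter_mem_le fin) auto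
  moreover have "card F5 \<le> card V5"
    unfolding F5_def c_def J_def using f5 xV(2) a by (intro card_filter_mem_le fin) (auto simp: int_pow_inv)
  moreover have "card (F1 \<union> F2 \<union> F3 \<union> F4 \<union> F5) \<le> card F1 + card F2 + card F3 + card F4 + card F5"
    by (meson add_le_mono card_Un_le order_refl order_trans)
  ultimately have "card (F1 \<union> F2 \<union> F3 \<union> F4 \<union> F5) < card J"
    using D unfolding J_def by simp
  moreover have "finite (F1 \<union> F2 \<union> F3 \<union> F4 \<union> F5)"
    using finite_atLeastAtMost_int[of 1 "int D"] unfolding F1_def F2_def F3_def F4_def F5_def J_def[symmetric] by simp
  ultimately have "\<not> J \<subseteq> F1 \<union> F2 \<union> F3 \<union> F4 \<union> F5" by (meson card_mono not_le)
  then obtain i where "i \<in> J" "i \<notin> F1 \<union> F2 \<union> F3 \<union> F4 \<union> F5" by blast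
  then have "x \<otimes> c i \<notin> V1 \<and> c i \<notin> V2 \<and> c i \<otimes> c i \<notin> V2 \<and>
    c i \<otimes> (x \<otimes> c i) \<notin> V4 \<and> inv (c i) \<otimes> (x \<otimes> c i) \<notin> V5"
    unfolding F1_def F2_def F3_def F4_def F5_def by blast
  moreover have "c i = a [^] (d * i)" using a unfolding c_def by (simp add: int_pow_pow)
  ultimately show ?thesis unfolding Let_def by metis
qed

text \<open>\<open>Q\<close> is the set of marks used so far: the new elements \<open>x c\<close> and \<open>(x c)\<^sup>-\<^sup>1\<close> create no new pair at
  an old mark. The assumption \<open>x\<^sup>2 \<notin> Q\<close> is needed since \<open>(x c)\<^sup>2 = x\<^sup>2\<close> whenever \<open>x\<close> inverts \<open>c\<close>.\<close>

lemma (in group) ex_generic_mark: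
  fixes D :: nat
  assumes a: "a \<in> carrier G"
    and B: "finite B" "B \<subseteq> carrier G" "\<forall>y \<in> B. inv y \<in> B"
    and Q: "finite Q" "Q \<subseteq> carrier G" "\<forall>q \<in> Q. inv q \<in> Q" "\<one> \<notin> Q"
    and x: "x \<in> B" "x \<otimes> x \<notin> Q"
    and ord: "order_exceeds a (2 * int D * int D)"
    and D: "2 * (card B)\<^sup>2 + 3 * card B + 2 * card B * card Q + card Q < D"
  shows "\<exists>c. c \<in> range (\<lambda>i::int. a [^] i) \<and> c \<noteq> \<one> \<and> (\<forall>y \<in> B. y \<otimes> y \<noteq> c \<and> y \<otimes> y \<noteq> inv c) \<and>
    x \<otimes> c \<notin> B \<and>
    (\<forall>y \<in> B \<union> {x \<otimes> c, inv (x \<otimes> c)}. \<forall>z \<in> B \<union> {x \<otimes> c, inv (x \<otimes> c)}.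
       (inv y \<otimes> z \<in> Q \<longrightarrow> y \<in> B \<and> z \<in> B) \<and>
       (inv y \<otimes> z \<in> {c, inv c} \<longrightarrow> y \<in> {x, inv x, x \<otimes> c, inv (x \<otimes> c)}))"
proof -
  have xG: "x \<in> carrier G" using x B by auto
  \<comment> \<open>For v = x c: \<open>V1\<close> prevents quotients in \<open>Q\<close> between v
    and \<open>B\<close>; \<open>V2\<close> prevents c from being a quotient in \<open>B\<close>,
    and also c^2 = x^-1 y; \<open>V4\<close> and \<open>V5\<close> control c x c and c^-1 x c. The
    value x must be permitted in the last two, as x may invert or centralise c whatever c
    is.\<close>
  define V1 where "V1 = B \<union> (B <#> Q) \<union> (Q <#> B)"
  define V2 where "V2 = B <#> B"
  define V4 where "V4 = (B \<union> (\<lambda>q. inv x \<otimes> q) ` Q) - {x}"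
  define V5 where "V5 = B - {x}"
  have fin: "finite V1" "finite V2" "finite V4" "finite V5"
    unfolding V1_def V2_def V4_def V5_def using B Q set_mult_card_le(1) by auto
  have c2: "card V2 \<le> (card B)\<^sup>2"
    unfolding V2_def power2_eq_square using set_mult_card_le(2) B by blast
  have c1: "card V1 \<le> card B + card B * card Q + card B * card Q"
  proof -
    have "card V1 \<le> card (B \<union> (B <#> Q)) + card (Q <#> B)" unfolding V1_def by (rule card_Un_le)
    moreover have "card (B \<union> (B <#> Q)) \<le> card B + card (B <#> Q)" by (rule card_Un_le)
    moreover have "card (B <#> Q) \<le> card B * card Q" "card (Q <#> B) \<le> card Q * card B"
      using set_mult_card_le(2) B Q by blast+
    ultimately show ?thesis by (simp add: mult.commute)
  qed
  have c4: "card V4 \<le> card B + card Q"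
  proof -
    have "card V4 \<le> card (B \<union> (\<lambda>q. inv x \<otimes> q) ` Q)" unfolding V4_def by (rule card_Diff1_le)
    also have "\<dots> \<le> card B + card ((\<lambda>q. inv x \<otimes> q) ` Q)" by (rule card_Un_le)
    also have "\<dots> \<le> card B + card Q" using Q(1) by (intro add_left_mono card_image_le)
    finally show ?thesis .
  qed
  have c5: "card V5 \<le> card B" unfolding V5_def by (rule card_Diff1_le)
  have "card V1 + 2 * card V2 + card V4 + card V5 < D"
    using c1 c2 c4 c5 D by linarith
  moreover have "x \<notin> V4" "x \<notin> V5" unfolding V4_def V5_def by auto
  ultimately obtain i :: int where i: "let c = a [^] i in x \<otimes> c \<notin> V1 \<and> c \<notin> V2 \<and> c \<otimes> c \<notin> V2 \<and>
      c \<otimes> (x \<otimes> c) \<notin> V4 \<and> inv c \<otimes> (x \<otimes> c) \<notin> V5"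
    using ex_avoiding_power[OF a xG ord fin] by blast
  define c where "c = a [^] i"
  define v where "v = x \<otimes> c"
  have c: "v \<notin> V1" "c \<notin> V2" "c \<otimes> c \<notin> V2" "c \<otimes> (x \<otimes> c) \<notin> V4" "inv c \<otimes> (x \<otimes> c) \<notin> V5"
    using i unfolding Let_def c_def v_def by auto
  have cG: "c \<in> carrier G" using a unfolding c_def by simp
  have vG: "v \<in> carrier G" unfolding v_def using xG cG by simp
  have BG: "y \<in> carrier G" if "y \<in> B" for y using that B by auto
  have QG: "q \<in> carrier G" if "q \<in> Q" for q using that Q by auto
  have mulI: "p \<otimes> q \<in> M <#> N" if "p \<in> M" "q \<in> N" for p q M N
    using that by (auto simp: set_mult_def)
  have vB: "v \<notin> B" using c(1) unfolding V1_def by blast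
  have vBQ: "v \<noteq> y \<otimes> q" "v \<noteq> q \<otimes> y" if "y \<in> B" "q \<in> Q" for y q
    using c(1) mulI that unfolding V1_def by blast+
  have cBB: "c \<noteq> y \<otimes> z" "c \<otimes> c \<noteq> y \<otimes> z" if "y \<in> B" "z \<in> B" for y z
    using c(2,3) mulI that unfolding V2_def by metis+
  have vv: "v \<otimes> v \<notin> Q"
  proof
    assume "v \<otimes> v \<in> Q"
    moreover have "c \<otimes> (x \<otimes> c) = inv x \<otimes> (v \<otimes> v)" unfolding v_def using xG cG by (simp add: m_assoc)
    ultimately have "c \<otimes> (x \<otimes> c) = x" using c(4) unfolding V4_def by blast
    then have "v \<otimes> v = x \<otimes> x" unfolding v_def using xG cG by (simp add: m_assoc)
    then show False using x(2) \<open>v \<otimes> v \<in> Q\<close> by simp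
  qed
  have keepQ: "y \<in> B \<and> z \<in> B" if yz: "y \<in> B \<union> {v, inv v}" "z \<in> B \<union> {v, inv v}" and q: "inv y \<otimes> z \<in> Q" for y z
  proof -
    let ?q = "inv y \<otimes> z"
    have G: "y \<in> carrier G" "z \<in> carrier G" using yz BG vG by auto
    have iq: "inv ?q \<in> Q" using q Q by blast
    have e: "z = y \<otimes> ?q" "y = z \<otimes> inv ?q" "inv z = inv ?q \<otimes> inv y" "inv y = ?q \<otimes> inv z"
      using G by (simp_all add: word_simps)
    have vv': "inv (v \<otimes> v) \<notin> Q" using vv Q vG by (metis inv_inv m_closed)
    have zB: "z \<noteq> v" "inv z \<noteq> v" if "y \<in> B"
      using vBQ[OF that q] vBQ[of "inv y" "inv ?q"] that B(3) iq e(1,3) by metis+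
    have yB: "y \<noteq> v" "inv y \<noteq> v" if "z \<in> B"
      using vBQ[OF that iq] vBQ[of "inv z" ?q] that B(3) q e(2,4) by metis+
    have none: False if "y \<in> {v, inv v}" "z \<in> {v, inv v}"
      using that q Q(4) vv vv' vG by (auto simp: inv_mult_group)
    show ?thesis using yz zB yB none vG by auto
  qed
  \<comment> \<open>A pair inside \<open>B\<close> is excluded by \<open>V2\<close>. If z = v, then
    y = x or c^2 = x^-1 y; if z = v^-1, then y^-1 is c x c or c^-1 x c, which lies in
    \<open>B\<close> only when it equals x.\<close>
  have unique: "y \<in> {x, inv x, v, inv v}"
    if yz: "y \<in> B \<union> {v, inv v}" "z \<in> B \<union> {v, inv v}" and q: "inv y \<otimes> z \<in> {c, inv c}" for y z
  proof (rule ccontr)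
    assume ny: "y \<notin> {x, inv x, v, inv v}"
    then have yB: "y \<in> B" using yz by blast
    have G: "y \<in> carrier G" "z \<in> carrier G" using yz BG vG by auto
    have iyB: "inv y \<in> B" using yB B by blast
    have iyx: "inv y \<noteq> x" using ny G by auto
    from q consider "inv y \<otimes> z = c" | "inv y \<otimes> z = inv c" by blast
    then show False
    proof cases
      case 1
      then have z: "z = y \<otimes> c" using G by (auto simp flip: 1)
      have "z \<notin> B" using cBB(1)[of "inv y" z] 1 iyB by auto
      then consider "z = v" | "z = inv v" using yz by blast
      then show False
      proof cases
        case 1
        then show False using z ny G xG cG unfolding v_def by auto
      next
        case 2
        then have "inv (y \<otimes> c) = v" using z vG by simp
        then have "inv c \<otimes> inv y = x \<otimes> c" unfolding v_def using G cG by (simp add: inv_mult_group)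
        then have "c \<otimes> (inv c \<otimes> inv y) = c \<otimes> (x \<otimes> c)" by simp
        then have "inv y = c \<otimes> (x \<otimes> c)" using G cG by simp
        then show False using c(4) iyB iyx unfolding V4_def by auto
      qed
    next
      case 2
      then have z: "z = y \<otimes> inv c" using G by (auto simp flip: 2)
      have c': "c = inv z \<otimes> y" using G cG by (simp add: z word_simps)
      have "z \<notin> B" using cBB(1)[of "inv z" y] c' yB B by auto
      then consider "z = v" | "z = inv v" using yz by blast
      then show False
      proof cases
        case 1
        then have "inv x \<otimes> (x \<otimes> c) \<otimes> c = inv x \<otimes> (y \<otimes> inv c) \<otimes> c" using z unfolding v_def by simp
        then have "c \<otimes> c = inv x \<otimes> y" using G xG cG by (simp add: m_assoc)
        then show False using cBB(2)[of "inv x" y] yB x B by blast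
      next
        case 2
        then have "inv (y \<otimes> inv c) = v" using z vG by simp
        then have "c \<otimes> inv y = x \<otimes> c" unfolding v_def using G cG by (simp add: inv_mult_group)
        then have "inv c \<otimes> (c \<otimes> inv y) = inv c \<otimes> (x \<otimes> c)" by simp
        then have "inv y = inv c \<otimes> (x \<otimes> c)" using G cG by simp
        then show False using c(5) iyB iyx unfolding V5_def by auto
      qed
    qed
  qed
  have c1: "c \<noteq> \<one>" using cBB(1)[of x "inv x"] x B xG by auto
  have sq: "y \<otimes> y \<noteq> c \<and> y \<otimes> y \<noteq> inv c" if y: "y \<in> B" for y
  proof -
    have "c = inv y \<otimes> inv y" if "y \<otimes> y = inv c"
    proof -
      have "inv (y \<otimes> y) = c" using that cG by simp
      then show ?thesis using BG[OF y] by (simp add: inv_mult_group)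
    qed
    then show ?thesis using cBB(1)[OF y y] cBB(1)[of "inv y" "inv y"] y B(3) by metis
  qed
  show ?thesis
    using c1 sq vB keepQ unique unfolding v_def c_def by (intro exI[of _ "a [^] i"]) blast
qed

section \<open>Marking the edges\<close>

text \<open>The marks are tested up to inversion because an automorphism may reverse a coset of
  \<langle>a\<rangle>. One mark would not suffice: the companion x c has x as its own partner at
  c^-1. The element x^-1 stays possible, for instance when x commutes with both marks and B is
  symmetric.\<close>

definition (in group) recognises :: "'a set \<Rightarrow> 'a \<Rightarrow> 'a \<Rightarrow> 'a \<Rightarrow> bool" where
  "recognises B x c d \<longleftrightarrow> x \<otimes> c \<in> B \<and> x \<otimes> d \<in> B \<and>
     (\<forall>y \<in> B. (y \<otimes> c \<in> B \<or> y \<otimes> inv c \<in> B) \<longrightarrow> (y \<otimes> d \<in> B \<or> y \<otimes> inv d \<in> B) \<longrightarrow> y \<in> {x, inv x})"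

text \<open>Elements of \<open>F\<close> are marked one at a time; each adds at most four elements
  to B (x c, x d and their inverses) and four to Q (c, d and their inverses). Old recognitions
  survive because new elements form no pair at an old mark. \<open>N\<close> and \<open>M\<close>
  bound the final sizes, so that one \<open>D\<close> serves all steps.\<close>

lemma (in group) ex_marked_set:
  fixes D :: nat
  assumes a: "a \<in> carrier G"
    and B0: "finite B0" "B0 \<subseteq> carrier G" "\<forall>y \<in> B0. inv y \<in> B0" "B0 \<inter> range (\<lambda>i::int. a [^] i) = {}"
    and F: "finite F" "F \<subseteq> B0"
    and ord: "order_exceeds a (2 * int D * int D)"
    and bound: "card B0 + 4 * card F \<le> N" "4 * card F \<le> M" "2 * N\<^sup>2 + 3 * N + 2 * N * M + M < D"
  shows "\<exists>B Q. B0 \<subseteq> B \<and> finite B \<and> B \<subseteq> carrier G \<and> (\<forall>y \<in> B. inv y \<in> B) \<and>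
    B \<inter> range (\<lambda>i::int. a [^] i) = {} \<and> card B \<le> card B0 + 4 * card F \<and>
    finite Q \<and> Q \<subseteq> range (\<lambda>i::int. a [^] i) \<and> (\<forall>q \<in> Q. inv q \<in> Q) \<and> \<one> \<notin> Q \<and>
    (\<forall>y \<in> B0. y \<otimes> y \<notin> Q) \<and> card Q \<le> 4 * card F \<and>
    (\<forall>x \<in> F. \<exists>c \<in> Q. \<exists>d \<in> Q. recognises B x c d)"
  using F bound(1,2)
proof (induction F)
  case empty
  then show ?case using B0 by (intro exI[of _ B0] exI[of _ "{}"]) auto
next
  case (insert x F)
  let ?C = "range (\<lambda>i::int. a [^] i)"
  have CG: "?C \<subseteq> carrier G" using a by auto
  have Cinv: "inv c \<in> ?C" if "c \<in> ?C" for c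
    using that a by (auto simp flip: int_pow_neg)
  have xB0: "x \<in> B0" using insert.prems by auto
  then have xG: "x \<in> carrier G" using B0 by auto
  from insert obtain B Q where BQ: "B0 \<subseteq> B" "finite B" "B \<subseteq> carrier G" "\<forall>y \<in> B. inv y \<in> B"
      "B \<inter> ?C = {}" "card B \<le> card B0 + 4 * card F"
      "finite Q" "Q \<subseteq> ?C" "\<forall>q \<in> Q. inv q \<in> Q" "\<one> \<notin> Q"
      "\<forall>y \<in> B0. y \<otimes> y \<notin> Q" "card Q \<le> 4 * card F"
      "\<forall>x \<in> F. \<exists>c \<in> Q. \<exists>d \<in> Q. recognises B x c d"
    by auto
  have cardF: "card (insert x F) = card F + 1" using insert.hyps by simp
  \<comment> \<open>Stated for variable sets because it is applied twice, for the first mark c and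
    then, with enlarged sets, for the second mark d.\<close>
  have step: "\<exists>c. c \<in> ?C \<and> c \<noteq> \<one> \<and> (\<forall>y \<in> B'. y \<otimes> y \<noteq> c \<and> y \<otimes> y \<noteq> inv c) \<and> x \<otimes> c \<notin> B' \<and>
      (\<forall>y \<in> B' \<union> {x \<otimes> c, inv (x \<otimes> c)}. \<forall>z \<in> B' \<union> {x \<otimes> c, inv (x \<otimes> c)}.
         (inv y \<otimes> z \<in> Q' \<longrightarrow> y \<in> B' \<and> z \<in> B') \<and>
         (inv y \<otimes> z \<in> {c, inv c} \<longrightarrow> y \<in> {x, inv x, x \<otimes> c, inv (x \<otimes> c)}))"
    if "B0 \<subseteq> B'" "finite B'" "B' \<subseteq> carrier G" "\<forall>y \<in> B'. inv y \<in> B'" "card B' \<le> N"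
      "finite Q'" "Q' \<subseteq> ?C" "\<forall>q \<in> Q'. inv q \<in> Q'" "\<one> \<notin> Q'" "\<forall>y \<in> B0. y \<otimes> y \<notin> Q'" "card Q' \<le> M"
    for B' Q'
  proof (rule ex_generic_mark[OF a that(2,3,4,6) _ that(8,9) _ _ ord])
    show "Q' \<subseteq> carrier G" using that(7) CG by blast
    show "x \<in> B'" "x \<otimes> x \<notin> Q'" using that xB0 by auto
    have "2 * (card B')\<^sup>2 + 3 * card B' + 2 * card B' * card Q' + card Q' \<le> 2 * N\<^sup>2 + 3 * N + 2 * N * M + M"
      using that(5,11) by (intro add_mono mult_mono power_mono) auto
    then show "2 * (card B')\<^sup>2 + 3 * card B' + 2 * card B' * card Q' + card Q' < D" using bound(3) by linarith
  qed
  have noC: "x \<otimes> c \<notin> ?C" "inv (x \<otimes> c) \<notin> ?C" if c: "c \<in> ?C" for c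
  proof -
    obtain i :: int where i: "c = a [^] i" using c by blast
    show *: "x \<otimes> c \<notin> ?C"
    proof
      assume "x \<otimes> c \<in> ?C"
      then obtain j :: int where "x \<otimes> c = a [^] j" by blast
      then have "x \<otimes> c \<otimes> inv c = a [^] j \<otimes> inv (a [^] i)" using i by simp
      then have "x = a [^] (j - i)" using i xG a by (simp add: m_assoc int_pow_diff)
      then show False using xB0 B0(4) by auto
    qed
    have "x \<otimes> c \<in> carrier G" using xG a i by simp
    then show "inv (x \<otimes> c) \<notin> ?C" using * Cinv[of "inv (x \<otimes> c)"] by (metis inv_inv)
  qed
  have "card B \<le> N" "card Q \<le> M" using BQ insert.prems cardF by auto
  from step[OF BQ(1-4) this(1) BQ(7-11) this(2)] obtain c where
    c: "c \<in> ?C" "c \<noteq> \<one>" "\<forall>y \<in> B. y \<otimes> y \<noteq> c \<and> y \<otimes> y \<noteq> inv c" "x \<otimes> c \<notin> B" and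
    c': "\<forall>y \<in> B \<union> {x \<otimes> c, inv (x \<otimes> c)}. \<forall>z \<in> B \<union> {x \<otimes> c, inv (x \<otimes> c)}.
         (inv y \<otimes> z \<in> Q \<longrightarrow> y \<in> B \<and> z \<in> B) \<and>
         (inv y \<otimes> z \<in> {c, inv c} \<longrightarrow> y \<in> {x, inv x, x \<otimes> c, inv (x \<otimes> c)})"
    by - (elim exE conjE, rule that)
  have cG: "c \<in> carrier G" using c CG by blast
  define B1 Q1 where "B1 = B \<union> {x \<otimes> c, inv (x \<otimes> c)}" and "Q1 = Q \<union> {c, inv c}"
  have two: "card {p, q} \<le> 2" for p q :: 'a by (simp add: card_insert_if)
  have B1: "B0 \<subseteq> B1" "finite B1" "B1 \<subseteq> carrier G" "\<forall>y \<in> B1. inv y \<in> B1" "B1 \<inter> ?C = {}"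
    using BQ(1-5) xG cG noC[OF c(1)] unfolding B1_def by auto
  have cB1: "card B1 \<le> card B + 2" using two order_trans[OF card_Un_le] unfolding B1_def by (meson add_left_mono)
  have Q1: "finite Q1" "Q1 \<subseteq> ?C" "\<forall>q \<in> Q1. inv q \<in> Q1" "\<one> \<notin> Q1" "\<forall>y \<in> B0. y \<otimes> y \<notin> Q1"
  proof -
    have "\<one> \<noteq> inv c" using c(2) cG by (metis inv_inv inv_one)
    then show "\<one> \<notin> Q1" unfolding Q1_def using BQ(10) c(2) by blast
    show "\<forall>q \<in> Q1. inv q \<in> Q1" unfolding Q1_def using BQ(9) cG by force
    show "Q1 \<subseteq> ?C" unfolding Q1_def using BQ(8) c(1) Cinv[OF c(1)] by blast
    show "\<forall>y \<in> B0. y \<otimes> y \<notin> Q1" unfolding Q1_def using BQ(1,11) c(3) by blast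
  qed (simp add: Q1_def BQ(7))
  have cQ1: "card Q1 \<le> card Q + 2" using two order_trans[OF card_Un_le] unfolding Q1_def by (meson add_left_mono)
  have "card B1 \<le> N" "card Q1 \<le> M" using cB1 cQ1 BQ(6,12) insert.prems cardF by auto
  from step[OF B1(1-4) this(1) Q1 this(2)] obtain d where
    d: "d \<in> ?C" "d \<noteq> \<one>" "\<forall>y \<in> B1. y \<otimes> y \<noteq> d \<and> y \<otimes> y \<noteq> inv d" "x \<otimes> d \<notin> B1" and
    d': "\<forall>y \<in> B1 \<union> {x \<otimes> d, inv (x \<otimes> d)}. \<forall>z \<in> B1 \<union> {x \<otimes> d, inv (x \<otimes> d)}.
         (inv y \<otimes> z \<in> Q1 \<longrightarrow> y \<in> B1 \<and> z \<in> B1) \<and>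
         (inv y \<otimes> z \<in> {d, inv d} \<longrightarrow> y \<in> {x, inv x, x \<otimes> d, inv (x \<otimes> d)})"
    by - (elim exE conjE, rule that)
  have dG: "d \<in> carrier G" using d CG by blast
  define B2 Q2 where "B2 = B1 \<union> {x \<otimes> d, inv (x \<otimes> d)}" and "Q2 = Q1 \<union> {d, inv d}"
  have B2: "B0 \<subseteq> B2" "finite B2" "B2 \<subseteq> carrier G" "\<forall>y \<in> B2. inv y \<in> B2" "B2 \<inter> ?C = {}"
    using B1 xG dG noC[OF d(1)] unfolding B2_def by auto
  have cB2: "card B2 \<le> card B1 + 2" using two order_trans[OF card_Un_le] unfolding B2_def by (meson add_left_mono)
  have Q2: "finite Q2" "Q2 \<subseteq> ?C" "\<forall>q \<in> Q2. inv q \<in> Q2" "\<one> \<notin> Q2" "\<forall>y \<in> B0. y \<otimes> y \<notin> Q2"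
  proof -
    have "\<one> \<noteq> inv d" using d(2) dG by (metis inv_inv inv_one)
    then show "\<one> \<notin> Q2" unfolding Q2_def using Q1(4) d(2) by blast
    show "\<forall>q \<in> Q2. inv q \<in> Q2" unfolding Q2_def using Q1(3) dG by force
    show "Q2 \<subseteq> ?C" unfolding Q2_def using Q1(2) d(1) Cinv[OF d(1)] by blast
    show "\<forall>y \<in> B0. y \<otimes> y \<notin> Q2" unfolding Q2_def using B1(1) Q1(5) d(3) by blast
  qed (simp add: Q2_def Q1(1))
  have cQ2: "card Q2 \<le> card Q1 + 2" using two order_trans[OF card_Un_le] unfolding Q2_def by (meson add_left_mono)
  \<comment> \<open>A pair at an old mark found in the enlarged set was already present before the
    enlargement.\<close>
  have back1: "y \<in> B \<and> y \<otimes> q \<in> B" if "y \<in> B1" "y \<otimes> q \<in> B1" "q \<in> Q" for y q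
  proof -
    have "y \<in> carrier G" "q \<in> carrier G" using that B1(3) BQ(8) CG by auto
    then have "inv y \<otimes> (y \<otimes> q) \<in> Q" using that by simp
    then show ?thesis using c' that unfolding B1_def by blast
  qed
  have back2: "y \<in> B1 \<and> y \<otimes> q \<in> B1" if "y \<in> B2" "y \<otimes> q \<in> B2" "q \<in> Q1" for y q
  proof -
    have "y \<in> carrier G" "q \<in> carrier G" using that B2(3) Q1(2) CG by auto
    then have "inv y \<otimes> (y \<otimes> q) \<in> Q1" using that by simp
    then show ?thesis using d' that unfolding B2_def by blast
  qed
  have "recognises B2 x c d"
    unfolding recognises_def
  proof (intro conjI ballI impI)
    show "x \<otimes> c \<in> B2" "x \<otimes> d \<in> B2" unfolding B2_def B1_def by auto
    fix y assume y: "y \<in> B2" "y \<otimes> c \<in> B2 \<or> y \<otimes> inv c \<in> B2" "y \<otimes> d \<in> B2 \<or> y \<otimes> inv d \<in> B2"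
    have yG: "y \<in> carrier G" using y(1) B2(3) by auto
    have canc: "inv y \<otimes> (y \<otimes> q) = q" if "q \<in> carrier G" for q using that yG by simp
    have "c \<in> Q1" "inv c \<in> Q1" unfolding Q1_def by auto
    then have y1: "y \<in> B1" "y \<otimes> c \<in> B1 \<or> y \<otimes> inv c \<in> B1" using back2 y by blast+
    have y2: "y \<in> {x, inv x, x \<otimes> d, inv (x \<otimes> d)}"
      using d' y(1,3) canc[OF dG] canc[OF inv_closed[OF dG]] unfolding B2_def by (metis insertCI)
    \<comment> \<open>The mark d leaves four candidates for y. The mark c forces y into
      \<open>B1\<close>, which contains neither x d nor its inverse, so only x and x^-1
      remain.\<close>
    have "inv (x \<otimes> d) \<notin> B1"
    proof
      assume "inv (x \<otimes> d) \<in> B1"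
      then have "inv (inv (x \<otimes> d)) \<in> B1" using B1(4) by blast
      then show False using d(4) xG dG by simp
    qed
    then show "y \<in> {x, inv x}" using y2 y1(1) d(4) by blast
  qed
  moreover have "\<exists>c \<in> Q2. \<exists>d \<in> Q2. recognises B2 x' c d" if x'F: "x' \<in> F" for x'
  proof -
    obtain p q where pq: "p \<in> Q" "q \<in> Q" and rec: "recognises B x' p q" using BQ(13) x'F by blast
    have inv: "inv p \<in> Q" "inv q \<in> Q" using pq BQ(9) by auto
    have QQ: "r \<in> Q1" if "r \<in> Q" for r using that unfolding Q1_def by auto
    have stays: "y \<in> B \<and> y \<otimes> r \<in> B" if "y \<in> B2" "y \<otimes> r \<in> B2" "r \<in> Q" for y r
      using back1 back2 QQ that by blast
    have "recognises B2 x' p q"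
      unfolding recognises_def
    proof (intro conjI ballI impI)
      show "x' \<otimes> p \<in> B2" "x' \<otimes> q \<in> B2" using rec unfolding recognises_def B2_def B1_def by auto
      fix y assume y: "y \<in> B2" "y \<otimes> p \<in> B2 \<or> y \<otimes> inv p \<in> B2" "y \<otimes> q \<in> B2 \<or> y \<otimes> inv q \<in> B2"
      have "y \<in> B" "y \<otimes> p \<in> B \<or> y \<otimes> inv p \<in> B"
        using y(1,2) stays[of y p] stays[of y "inv p"] pq(1) inv(1) by metis+
      moreover have "y \<otimes> q \<in> B \<or> y \<otimes> inv q \<in> B"
        using y(1,3) stays[of y q] stays[of y "inv q"] pq(2) inv(2) by metis
      ultimately show "y \<in> {x', inv x'}" using rec unfolding recognises_def by metis
    qed
    then show ?thesis using pq QQ unfolding Q2_def by blast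
  qed
  moreover have "c \<in> Q2" "d \<in> Q2" unfolding Q2_def Q1_def by auto
  ultimately have "\<forall>x' \<in> insert x F. \<exists>c \<in> Q2. \<exists>d \<in> Q2. recognises B2 x' c d" by blast
  moreover have "card B2 \<le> card B0 + 4 * card (insert x F)" "card Q2 \<le> 4 * card (insert x F)"
    using cB1 cB2 cQ1 cQ2 BQ(6,12) cardF by linarith+
  ultimately show ?case using B2 Q2 by blast
qed

text \<open>Elements of \<open>S0\<close> inside \<langle>a\<rangle> have their colours controlled
  by the isometries of the cosets, so only the remaining ones, forming \<open>F\<close>, receive
  marks.\<close>

lemma (in group) ex_colour_preserving_Cayley_graph:
  assumes a: "a \<in> carrier G" and S0: "finite S0" "S0 \<subseteq> carrier G" "S0 \<noteq> {}" "generate G S0 = carrier G"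
    and ord: "order_exceeds a (2 * int (143 * (card S0)\<^sup>2) * int (143 * (card S0)\<^sup>2))"
  shows "\<exists>S. finite S \<and> S \<subseteq> carrier G \<and> \<one> \<notin> S \<and> generate G S = carrier G \<and>
    (\<forall>\<phi> \<in> graph_automorphisms (Cayley_graph G S). colour_preserving S0 \<phi>)"
proof -
  define C where "C = range (\<lambda>i::int. a [^] i)"
  define B0 where "B0 = (S0 \<union> (\<lambda>x. inv x) ` S0) - C"
  define F where "F = S0 - C"
  define s where "s = card S0"
  have s: "1 \<le> s" unfolding s_def using S0 by (simp add: Suc_leI card_gt_0_iff)
  have Cinv: "inv c \<in> C" if "c \<in> C" for c
    using that a unfolding C_def by (auto simp flip: int_pow_neg)
  have B0: "finite B0" "B0 \<subseteq> carrier G" "\<forall>y \<in> B0. inv y \<in> B0" "B0 \<inter> C = {}"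
  proof -
    show "\<forall>y \<in> B0. inv y \<in> B0"
    proof
      fix y assume y: "y \<in> B0"
      then have yG: "y \<in> carrier G" unfolding B0_def using S0 by auto
      have "inv y \<notin> C"
        using y Cinv[of "inv y"] yG unfolding B0_def by auto
      moreover have "inv y \<in> S0 \<union> (\<lambda>x. inv x) ` S0" using y S0(2) unfolding B0_def by auto
      ultimately show "inv y \<in> B0" unfolding B0_def by blast
    qed
  qed (use S0 in \<open>auto simp: B0_def\<close>)
  have F: "finite F" "F \<subseteq> B0" unfolding F_def B0_def using S0 by auto
  have cF: "card F \<le> s" unfolding F_def s_def using S0(1) by (intro card_mono) auto
  have cB0: "card B0 \<le> 2 * s"
  proof -
    have "card B0 \<le> card (S0 \<union> (\<lambda>x. inv x) ` S0)" unfolding B0_def using S0(1) by (intro card_mono) auto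
    also have "\<dots> \<le> card S0 + card ((\<lambda>x. inv x) ` S0)" by (rule card_Un_le)
    also have "\<dots> \<le> card S0 + card S0" using S0(1) by (intro add_left_mono card_image_le)
    finally show ?thesis unfolding s_def by simp
  qed
  have ss: "s \<le> s\<^sup>2" using s by (simp add: power2_eq_square)
  \<comment> \<open>The bounds are N = 2 s + 4 s and M = 4 s. The left side equals 120 s^2 + 22 s
    \<le> 142 s^2, which explains the constant 143.\<close>
  have "2 * (6 * s)\<^sup>2 + 3 * (6 * s) + 2 * (6 * s) * (4 * s) + 4 * s < 143 * s\<^sup>2"
    using ss s by (simp add: power2_eq_square)
  then obtain B Q where B: "B0 \<subseteq> B" "finite B" "B \<subseteq> carrier G" "\<forall>y \<in> B. inv y \<in> B" "B \<inter> C = {}"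
      "card B \<le> card B0 + 4 * card F" and Q: "Q \<subseteq> C"
      and rec: "\<forall>x \<in> F. \<exists>c \<in> Q. \<exists>d \<in> Q. recognises B x c d"
    using ex_marked_set[OF a B0[unfolded C_def] F ord[folded s_def], of "6 * s" "4 * s"] cB0 cF
    unfolding C_def[symmetric] by auto
  define m where "m = 2 * int (card B) + 2"
  define A where "A = {a [^] i | i::int. i \<noteq> 0 \<and> \<bar>i\<bar> \<le> m}"
  have m2: "2 \<le> m" unfolding m_def by simp
  have "int (card B) \<le> 6 * int s" using B(6) cB0 cF by linarith
  then have "4 * m \<le> 48 * int s + 8" unfolding m_def by simp
  also have "\<dots> \<le> 2 * int (143 * s\<^sup>2) * int (143 * s\<^sup>2)"
  proof -
    have 1: "int s \<le> int s ^ 4" "1 \<le> int s ^ 4" using s self_le_power[of "int s" 4] by (auto intro: one_le_power)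
    have "2 * int (143 * s\<^sup>2) * int (143 * s\<^sup>2) = 40898 * int s ^ 4" by (simp add: power2_eq_square power4_eq_xxxx)
    then show ?thesis using 1 by linarith
  qed
  finally have ordm: "order_exceeds a (4 * m)"
    using ord unfolding order_exceeds_def s_def by auto
  have aB: "a [^] i \<notin> B" for i :: int using B(5) unfolding C_def by auto
  have one: "\<one> \<notin> A \<union> B"
  proof -
    have "\<one> \<notin> A"
    proof
      assume "\<one> \<in> A"
      then obtain i :: int where i: "a [^] i = a [^] (0::int)" "i \<noteq> 0" "\<bar>i\<bar> \<le> m" unfolding A_def by auto
      then show False using int_pow_cancel[OF a ordm i(1)] m2 by linarith
    qed
    then show ?thesis using aB[of 0] by simp
  qed
  have finA: "finite A"
  proof -
    have "A \<subseteq> (\<lambda>i. a [^] i) ` {-m..m}" unfolding A_def by (auto simp: abs_le_iff intro!: imageI)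
    then show ?thesis using finite_subset by blast
  qed
  have AG: "A \<subseteq> carrier G" unfolding A_def using a by auto
  have aA: "a \<in> A" unfolding A_def using a m2 by (auto intro!: exI[of _ "1::int"])
  have a2: "a \<otimes> a \<noteq> \<one>"
  proof -
    have "a [^] (2::int) \<noteq> \<one>" using ordm m2 unfolding order_exceeds_def by auto
    moreover have "a [^] (2::int) = a \<otimes> a" using a int_pow_mult[of a 1 1] by simp
    ultimately show ?thesis by simp
  qed
  have subS: "subgroup (generate G (A \<union> B)) G" using AG B(3) by (intro generate_is_subgroup) auto
  have "S0 \<subseteq> generate G (A \<union> B)"
  proof
    fix x assume x: "x \<in> S0"
    show "x \<in> generate G (A \<union> B)"
    proof (cases "x \<in> C")
      case True
      then obtain i :: int where "x = a [^] i" unfolding C_def by blast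
      then show ?thesis using subgroup_int_pow_closed[OF subS] aA by (simp add: generate.incl)
    next
      case False
      then have "x \<in> B" using x B(1) F(2) unfolding F_def by blast
      then show ?thesis by (simp add: generate.incl)
    qed
  qed
  then have gen: "generate G (A \<union> B) = carrier G"
    using generate_subgroup_incl[OF _ subS] S0(4) subgroup.subset[OF subS] by blast
  have "colour_preserving S0 \<phi>" if \<phi>: "\<phi> \<in> graph_automorphisms (Cayley_graph G (A \<union> B))" for \<phi>
  proof -
    have Sinv: "\<forall>y \<in> A \<union> B. inv y \<in> A \<union> B"
    proof -
      have "inv y \<in> A" if y: "y \<in> A" for y
      proof -
        obtain i :: int where "y = a [^] i" "i \<noteq> 0" "\<bar>i\<bar> \<le> m" using y unfolding A_def by blast
        then show ?thesis unfolding A_def using a by (intro CollectI exI[of _ "-i"]) (simp add: int_pow_neg)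
      qed
      then show ?thesis using B(4) by auto
    qed
    have bij: "bij_betw \<phi> (carrier G) (carrier G)"
      using Cayley_automorphismD(1)[OF _ Sinv \<phi>] AG B(3) by blast
    have \<phi>G: "\<phi> x \<in> carrier G" if "x \<in> carrier G" for x using bij that by (auto dest: bij_betwE)
    note adj = Cayley_automorphism_preserves_cosets[OF a B(2,3,4) aB m_def ordm A_def \<phi>]
    have step: "\<phi> (g \<otimes> a) = \<phi> g \<otimes> a \<or> \<phi> (g \<otimes> a) = \<phi> g \<otimes> inv a" if "g \<in> carrier G" for g
      by (rule interval_automorphism_step[OF a m2 ordm A_def bij adj(1) that])
    have line: "\<phi> (g \<otimes> c) = \<phi> g \<otimes> c \<or> \<phi> (g \<otimes> c) = \<phi> g \<otimes> inv c" if "g \<in> carrier G" "c \<in> C" for g c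
      using line_isometry[OF a a2 bij step that(1)] that(2) unfolding C_def by blast
    have "\<phi> (g \<otimes> x) = \<phi> g \<otimes> x \<or> \<phi> (g \<otimes> x) = \<phi> g \<otimes> inv x" if g: "g \<in> carrier G" and x: "x \<in> S0" for g x
    proof (cases "x \<in> C")
      case True
      then show ?thesis using line g by blast
    next
      case False
      then have xF: "x \<in> F" using x unfolding F_def by blast
      have xG: "x \<in> carrier G" using x S0 by auto
      obtain c d where cd: "c \<in> C" "d \<in> C" and r: "recognises B x c d" using rec xF Q by blast
      \<comment> \<open>The label of the image edge. For a mark e, the image of the path g, g x, g x
        e shows that y e or y e^-1 is in \<open>B\<close>; so y passes the recognition test for
        x.\<close>
      define y where "y = inv (\<phi> g) \<otimes> \<phi> (g \<otimes> x)"
      have yG: "y \<in> carrier G" unfolding y_def using \<phi>G g xG by simp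
      have "x \<in> B" using xF F(2) B(1) by blast
      then have yB: "y \<in> B" unfolding y_def using adj(2)[of g "g \<otimes> x"] g xG by simp
      have "y \<otimes> e \<in> B \<or> y \<otimes> inv e \<in> B" if e: "e \<in> C" "x \<otimes> e \<in> B" for e
      proof -
        have eG: "e \<in> carrier G" using e a unfolding C_def by auto
        have "inv (\<phi> g) \<otimes> \<phi> (g \<otimes> x \<otimes> e) \<in> B"
          using adj(2)[of g "g \<otimes> x \<otimes> e"] g xG eG e(2) by (simp add: m_assoc)
        moreover have "\<phi> (g \<otimes> x \<otimes> e) = \<phi> (g \<otimes> x) \<otimes> e \<or> \<phi> (g \<otimes> x \<otimes> e) = \<phi> (g \<otimes> x) \<otimes> inv e"
          using line[of "g \<otimes> x" e] g xG e(1) by simp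
        moreover have "inv (\<phi> g) \<otimes> (\<phi> (g \<otimes> x) \<otimes> f) = y \<otimes> f" if "f \<in> carrier G" for f
          unfolding y_def using \<phi>G g xG that by (simp add: m_assoc)
        ultimately show ?thesis using eG inv_closed by metis
      qed
      then have "y \<in> {x, inv x}" using r cd yB unfolding recognises_def by blast
      moreover have "\<phi> (g \<otimes> x) = \<phi> g \<otimes> y" unfolding y_def using \<phi>G g xG by simp
      ultimately show ?thesis by auto
    qed
    then show ?thesis unfolding colour_preserving_def using \<phi>G by blast
  qed
  then show ?thesis using finA B AG one gen by (intro exI[of _ "A \<union> B"]) auto
qed

section \<open>The theorem\<close>

lemma (in group) order_exceedsI:
  assumes a: "a \<in> carrier G" and ord: "ord a = 0 \<or> R < int (ord a)"
  shows "order_exceeds a R"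
  unfolding order_exceeds_def
proof (intro allI impI)
  fix k :: int assume k: "0 < k" "k \<le> R"
  have "a [^] k = a [^] nat k" using k by (metis int_pow_int int_nat_eq order_less_imp_le)
  moreover have "\<not> ord a dvd nat k" using ord k by (cases "ord a = 0") (auto dest: dvd_imp_le)
  ultimately show "a [^] k \<noteq> \<one>" using pow_eq_id[OF a] by simp
qed

lemma (in group) two_le_card_generating_set:
  assumes "finite Y" "Y \<subseteq> carrier G" "generate G Y = carrier G" "\<not> comm_group G"
  shows "2 \<le> card Y"
proof (rule ccontr)
  assume "\<not> 2 \<le> card Y"
  then have "card Y \<le> Suc 0" by simp
  then have "y \<otimes> z = z \<otimes> y" if "y \<in> Y" "z \<in> Y" for y z
    using card_le_Suc0_iff_eq[OF assms(1)] that by metis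
  then have "comm_group G"
    using generate_pairwise_commuting[OF assms(2)] assms(3) by (intro group_comm_groupI) blast
  then show False using assms(4) by simp
qed

lemma (in group) locally_finite_Cayley_graph:
  assumes S: "finite S" "S \<subseteq> carrier G"
  shows "locally_finite_graph (Cayley_graph G S)"
proof -
  let ?T = "S \<union> set_inv S"
  have T: "finite ?T" using S by (simp add: SET_INV_def)
  have "finite {e \<in> snd (Cayley_graph G S). fst e = v \<or> snd e = v}" if v: "v \<in> carrier G" for v
  proof (rule finite_subset)
    show "{e \<in> snd (Cayley_graph G S). fst e = v \<or> snd e = v} \<subseteq>
        (\<lambda>t. (v, v \<otimes> t)) ` ?T \<union> (\<lambda>t. (v \<otimes> inv t, v)) ` ?T"
    proof
      fix e assume "e \<in> {e \<in> snd (Cayley_graph G S). fst e = v \<or> snd e = v}"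
      then obtain g h where e: "e = (g, h)" "g \<in> carrier G" "h \<in> carrier G" "inv g \<otimes> h \<in> ?T"
          and gh: "g = v \<or> h = v"
        unfolding Cayley_graph_def by auto
      have "h = g \<otimes> (inv g \<otimes> h)" "g = h \<otimes> inv (inv g \<otimes> h)"
        using e by (simp_all add: word_simps)
      then have "e = (v, v \<otimes> (inv g \<otimes> h)) \<or> e = (v \<otimes> inv (inv g \<otimes> h), v)"
        using e(1) gh by metis
      then show "e \<in> (\<lambda>t. (v, v \<otimes> t)) ` ?T \<union> (\<lambda>t. (v \<otimes> inv t, v)) ` ?T"
        using e(4) by blast
    qed
    show "finite ((\<lambda>t. (v, v \<otimes> t)) ` ?T \<union> (\<lambda>t. (v \<otimes> inv t, v)) ` ?T)" using T by blast
  qed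
  then show ?thesis unfolding locally_finite_graph_def by (simp add: Cayley_graph_def)
qed

lemma (in group) ex_graphical_regular_representation:
  assumes fg: "finitely_generated G" and nc: "\<not> comm_group G" and nd: "\<not> generalized_dicyclic G"
    and ord: "\<exists>a \<in> carrier G. ord a = 0 \<or> ord a \<ge> (2 * group_rank G) ^ 36"
  shows "\<exists>S. generating_set G S \<and> \<one> \<notin> S \<and>
    locally_finite_graph (Cayley_graph G S) \<and>
    graph_automorphisms (Cayley_graph G S) = left_multiplications G"
proof -
  define r where "r = group_rank G"
  have "\<exists>Y. finite Y \<and> card Y = r \<and> generating_set G Y"
    unfolding r_def group_rank_def
    by (rule LeastI_ex) (use fg in \<open>auto simp: finitely_generated_def\<close>)
  then obtain Y where Y: "finite Y" "card Y = r" "Y \<subseteq> carrier G" "generate G Y = carrier G"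
    unfolding generating_set_def by blast
  have r: "2 \<le> r" using two_le_card_generating_set[OF Y(1,3,4) nc] Y(2) by simp
  obtain a where a: "a \<in> carrier G" "ord a = 0 \<or> ord a \<ge> (2 * r) ^ 36"
    using ord unfolding r_def by blast
  have large: "order_exceeds a R" if "R < int ((2 * r) ^ 36)" for R
    using a that by (intro order_exceedsI) linarith+
  \<comment> \<open>The scale 143 s^2 with s \<le> 5 (r + 2)^5 requires order above 2 * 143^2 s^4 =
    40898 s^4. Since r \<ge> 2, one has r + 2 \<le> 2 r and 40898 * 5^4 = 25561250 < 4^16 \<le> (2
    r)^16, so the exponent is 20 + 16 = 36.\<close>
  have pow: "40898 * (5 * (r + 2) ^ 5) ^ 4 < (2 * r) ^ 36"
  proof -
    have "(5 * (r + 2) ^ 5) ^ 4 \<le> (5 * (2 * r) ^ 5) ^ 4" using r by (intro power_mono mult_left_mono) auto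
    also have "\<dots> = 625 * (2 * r) ^ 20" by (simp add: power_mult_distrib flip: power_mult)
    finally have "40898 * (5 * (r + 2) ^ 5) ^ 4 \<le> 25561250 * (2 * r) ^ 20" by linarith
    also have "\<dots> < 4 ^ 16 * (2 * r) ^ 20" using r by (intro mult_strict_right_mono) auto
    also have "\<dots> \<le> (2 * r) ^ 16 * (2 * r) ^ 20" using r by (intro mult_right_mono power_mono) auto
    also have "\<dots> = (2 * r) ^ 36" by (simp flip: power_add)
    finally show ?thesis .
  qed
  \<comment> \<open>For b = a^2 the rigidity argument requires b^2 and b^4, that is a^4 and a^8, to
    be nontrivial.\<close>
  have nontrivial: "a [^] k \<noteq> \<one>" if "0 < k" "k \<le> 8" for k :: int
  proof -
    have "8 < (4::nat) ^ 36" by simp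
    also have "\<dots> \<le> (2 * r) ^ 36" using r by (intro power_mono) auto
    finally have "order_exceeds a 8" by (intro large) linarith
    then show ?thesis using that unfolding order_exceeds_def by blast
  qed
  have a4: "a [^] (4::int) = (a \<otimes> a) \<otimes> (a \<otimes> a)"
    using a(1) int_pow_mult[of a 1 1] int_pow_mult[of a 2 2] by simp
  have a8: "a [^] (8::int) = ((a \<otimes> a) \<otimes> (a \<otimes> a)) \<otimes> ((a \<otimes> a) \<otimes> (a \<otimes> a))"
    using int_pow_mult[OF a(1), of 4 4] a4 by simp
  obtain S0 where S0: "finite S0" "S0 \<subseteq> carrier G" "card S0 \<le> 5 * (r + 2) ^ 5" "generate G S0 = carrier G"
      and rigid: "\<And>\<phi> h. colour_preserving S0 \<phi> \<Longrightarrow> h \<in> carrier G \<Longrightarrow> \<phi> h = \<phi> \<one> \<otimes> h"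
    using ex_rigid_colouring[OF Y(1,3,4) a(1) _ _ nc nd] nontrivial[of 4] nontrivial[of 8] Y(2)
    unfolding a4 a8 by auto
  have "S0 \<noteq> {}"
  proof
    assume "S0 = {}"
    then show False using two_le_card_generating_set[OF S0(1,2,4) nc] by simp
  qed
  moreover have "order_exceeds a (2 * int (143 * (card S0)\<^sup>2) * int (143 * (card S0)\<^sup>2))"
  proof (rule large)
    have "2 * (143 * (card S0)\<^sup>2) * (143 * (card S0)\<^sup>2) = 40898 * card S0 ^ 4"
      by (simp add: power2_eq_square power4_eq_xxxx)
    also have "\<dots> \<le> 40898 * (5 * (r + 2) ^ 5) ^ 4" using S0(3) by (intro mult_left_mono power_mono) auto
    also have "\<dots> < (2 * r) ^ 36" by (rule pow)
    finally have "int (2 * (143 * (card S0)\<^sup>2) * (143 * (card S0)\<^sup>2)) < int ((2 * r) ^ 36)"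
      by (simp only: of_nat_less_iff)
    then show "2 * int (143 * (card S0)\<^sup>2) * int (143 * (card S0)\<^sup>2) < int ((2 * r) ^ 36)"
      by (simp only: of_nat_mult of_nat_numeral)
  qed
  ultimately obtain S where S: "finite S" "S \<subseteq> carrier G" "\<one> \<notin> S" "generate G S = carrier G"
      and col: "\<forall>\<phi> \<in> graph_automorphisms (Cayley_graph G S). colour_preserving S0 \<phi>"
    using ex_colour_preserving_Cayley_graph[OF a(1) S0(1,2) _ S0(4)] by blast
  have "\<phi> \<in> left_multiplications G" if \<phi>: "\<phi> \<in> graph_automorphisms (Cayley_graph G S)" for \<phi>
  proof -
    have ext: "\<phi> \<in> extensional (carrier G)" and bij: "bij_betw \<phi> (carrier G) (carrier G)"
      using \<phi> by (auto simp: graph_automorphisms_def Cayley_graph_def Bij_def)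
    \<comment> \<open>Both sides are undefined off the carrier, so agreement on the carrier is
      equality of functions.\<close>
    have "\<phi> = (\<lambda>x \<in> carrier G. \<phi> \<one> \<otimes> x)"
      by (rule extensionalityI[OF ext]) (use rigid col \<phi> in auto)
    moreover have "\<phi> \<one> \<in> carrier G" using bij by (auto dest: bij_betwE)
    ultimately show ?thesis unfolding left_multiplications_def by blast
  qed
  then have "graph_automorphisms (Cayley_graph G S) = left_multiplications G"
    using left_multiplications_subset_graph_automorphisms[OF S(2)] by blast
  moreover have "generating_set G S" unfolding generating_set_def using S by blast
  ultimately show ?thesis using S(3) locally_finite_Cayley_graph[OF S(1,2)] by blast
qed

theorem theorem1:
  fixes G :: "('a, 'b) monoid_scheme"
  assumes "group G"
    and "finitely_generated G"
    and "\<not> comm_group G"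
    and "\<not> generalized_dicyclic G"
    and "\<exists>a \<in> carrier G. group.ord G a = 0 \<or> group.ord G a \<ge> (2 * group_rank G) ^ 36"
  shows "\<exists>S. generating_set G S \<and> \<one>\<^bsub>G\<^esub> \<notin> S \<and>
    locally_finite_graph (Cayley_graph G S) \<and>
    graph_automorphisms (Cayley_graph G S) = left_multiplications G"
  using group.ex_graphical_regular_representation[OF assms] .

end
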